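(* For every $n\geq 1$ the $\Pi$-projective space $\mathbb{P}^n_\Pi$ has trivial Berezinian sheaf, that is, $\mathcal{B}er_{\mathbb{P}^n_\Pi}\cong\mathcal{O}_{\mathbb{P}^n_\Pi}$. In other words, $\mathbb{P}^n_\Pi$ is a Calabi-Yau supermanifold.
   Context: Work over $\mathbb{C}$ in the analytic category. A complex supermanifold $M$ of dimension $p|q$ is a locally ringed space $(M,\mathcal{O}_M)$ with $\mathcal{O}_M$ a sheaf of supercommutative rings such that, with $\mathcal{J}_M$ the ideal of nilpotents: $M_{red} = (M, \mathcal{O}_M/\mathcal{J}_M)$ is a complex manifold of dimension $p$, $\mathcal{F}_M = \mathcal{J}_M/\mathcal{J}_M^2$ is a locally free $\mathcal{O}_{M_{red}}$-module of rank $0|q$, and $\mathcal{O}_M$ is locally isomorphic, as a $\mathbb{Z}_2$-graded algebra, to $\bigwedge^\bullet_{\mathcal{O}_{M_{red}}}\mathcal{F}_M$. Berezinian sheaf: for an invertible even super matrix $X=\begin{pmatrix}A&B\\C&D\end{pmatrix}$ ($A,D$ with even entries, $B,C$ with odd entries), $\mathrm{Ber}(X)=\det(A)\det(D-CA^{-1}B)^{-1}$. The Berezinian sheaf of $M$ is $\mathcal{B}er_M=\mathcal{B}er(\Omega^1_M)$: given an open covering of $M$ by coordinate charts $\mathcal{U}_i$, it is the locally free sheaf of $\mathcal{O}_M$-modules whose transition functions on $\mathcal{U}_i\cap\mathcal{U}_j$ are the Berezinians of the super Jacobians of the changes of coordinates. A supermanifold is called Calabi-Yau if its Berezinian sheaf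 is trivial. $\Pi$-projective space: let $\mathcal{U}_i=\{X_i\neq 0\}\subset\mathbb{P}^n$, $i=0,\dots,n$. $\mathbb{P}^n_\Pi$ is the complex supermanifold of dimension $n|n$ over $\mathbb{P}^n$ parametrising $\Pi$-symmetric $1|1$-dimensional subspaces of $\mathbb{C}^{n+1|n+1}$. Explicitly, it is glued from $n+1$ affine charts $\tilde{\mathcal{U}}_i\cong\mathbb{C}^{n|n}$ over $\mathcal{U}_i$, with even coordinates $z_{\ell i}$ and odd coordinates $\theta_{\ell i}$ ($\ell\in\{0,\dots,n\}$, $\ell\neq i$). Set $z_{ii}=1$, $\theta_{ii}=0$, and associate to $\tilde{\mathcal{U}}_i$ the $1|1\times (n+1)|(n+1)$ super matrix $$\mathcal{Z}_i = \left(\begin{array}{ccc||ccc} z_{0i} & \cdots & z_{ni} & \theta_{0i} & \cdots & \theta_{ni}\\ \hline -\theta_{0i} & \cdots & -\theta_{ni} & z_{0i} & \cdots & z_{ni}\end{array}\right).$$ For $i\neq j$, let $\mathcal{B}_{ij}=\begin{pmatrix} z_{ji} & \theta_{ji}\\ -\theta_{ji} & z_{ji}\end{pmatrix}$ be the submatrix of $\mathcal{Z}_i$ formed by the $j$-th even and $j$-th odd columns; on the open locus where $\mathcal{B}_{ij}$ is invertible (lying over $\mathcal{U}_i\cap\mathcal{U}_j$) the charts are glued by $\mathcal{Z}_j=\mathcal{B}_{ij}^{-1}\mathcal{Z}_i$. On reduced spaces $z_{\ell i}=X_\ell/X_i$. *)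

theory Defs
  imports "HOL-Analysis.Analysis"
begin

section \<open>Grassmann algebras\<close>

text \<open>
  The complex Grassmann algebra on generators \<open>\<theta>\<^sub>a\<close>, \<open>a :: 'q\<close>. An element is its family of
  coefficients with respect to the basis \<open>\<theta>\<^sub>S = \<theta>\<^bsub>a1\<^esub> \<cdots> \<theta>\<^bsub>ar\<^esub>\<close>, \<open>S = {a1, \<dots>, ar}\<close>, where the
  generators are multiplied in increasing order of the enumeration \<open>to_nat\<close> of the finite
  type \<open>'q\<close>.
\<close>

typedef 'q grassmann = "UNIV :: ('q set \<Rightarrow> complex) set"
  morphisms gcoeff Grassmann by simp

setup_lifting type_definition_grassmann

text \<open>\<open>inversion_sign A B\<close> is the sign in \<open>\<theta>\<^sub>A \<theta>\<^sub>B = \<plusminus> \<theta>\<^bsub>A \<union> B\<^esub>\<close> for disjoint \<open>A\<close>, \<open>B\<close>.\<close>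

definition inversions :: "'q::finite set \<Rightarrow> 'q set \<Rightarrow> nat" where
  "inversions A B = card {(a, b). a \<in> A \<and> b \<in> B \<and> to_nat b < to_nat a}"

definition inversion_sign :: "'q::finite set \<Rightarrow> 'q set \<Rightarrow> complex" where
  "inversion_sign A B = (-1) ^ inversions A B"

lemma inversions_Un_left:
  assumes "A \<inter> B = {}"
  shows "inversions (A \<union> B) C = inversions A C + inversions B C"
proof -
  have "{(a, b). a \<in> A \<union> B \<and> b \<in> C \<and> to_nat b < to_nat a} =
      {(a, b). a \<in> A \<and> b \<in> C \<and> to_nat b < to_nat a} \<union> {(a, b). a \<in> B \<and> b \<in> C \<and> to_nat b < to_nat a}"
    by auto
  then show ?thesis
    unfolding inversions_def using assms by (simp only:) (rule card_Un_disjoint; auto)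
qed

lemma inversions_Un_right:
  assumes "B \<inter> C = {}"
  shows "inversions A (B \<union> C) = inversions A B + inversions A C"
proof -
  have "{(a, b). a \<in> A \<and> b \<in> B \<union> C \<and> to_nat b < to_nat a} =
      {(a, b). a \<in> A \<and> b \<in> B \<and> to_nat b < to_nat a} \<union> {(a, b). a \<in> A \<and> b \<in> C \<and> to_nat b < to_nat a}"
    by auto
  then show ?thesis
    unfolding inversions_def using assms by (simp only:) (rule card_Un_disjoint; auto)
qed

lemma inversions_empty [simp]: "inversions {} B = 0" "inversions A {} = 0"
  by (simp_all add: inversions_def)

lemma inversions_swap:
  assumes "A \<inter> B = {}"
  shows "inversions A B + inversions B A = card A * card B"
proof -
  let ?X = "{(a, b). a \<in> A \<and> b \<in> B \<and> to_nat b < to_nat a}"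
  let ?Y = "{(b, a). b \<in> B \<and> a \<in> A \<and> to_nat a < to_nat b}"
  have "A \<times> B = ?X \<union> prod.swap ` ?Y"
    using assms by (auto simp: image_iff)
  moreover have "card (?X \<union> prod.swap ` ?Y) = card ?X + card (prod.swap ` ?Y)"
    by (rule card_Un_disjoint) auto
  moreover have "card (prod.swap ` ?Y) = card ?Y"
    by (rule card_image) auto
  ultimately show ?thesis
    unfolding inversions_def by (simp flip: card_cartesian_product)
qed

instantiation grassmann :: (finite) ring_1
begin

lift_definition zero_grassmann :: "'a grassmann" is "\<lambda>_. 0" .
lift_definition one_grassmann :: "'a grassmann" is "\<lambda>S. if S = {} then 1 else 0" .
lift_definition plus_grassmann :: "'a grassmann \<Rightarrow> 'a grassmann \<Rightarrow> 'a grassmann"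
  is "\<lambda>x y S. x S + y S" .
lift_definition minus_grassmann :: "'a grassmann \<Rightarrow> 'a grassmann \<Rightarrow> 'a grassmann"
  is "\<lambda>x y S. x S - y S" .
lift_definition uminus_grassmann :: "'a grassmann \<Rightarrow> 'a grassmann"
  is "\<lambda>x S. - x S" .
lift_definition times_grassmann :: "'a grassmann \<Rightarrow> 'a grassmann \<Rightarrow> 'a grassmann"
  is "\<lambda>x y S. \<Sum>T\<in>Pow S. inversion_sign T (S - T) * x T * y (S - T)" .

instance
proof
  fix a b c :: "'a grassmann"
  show "a * b * c = a * (b * c)"
  proof (transfer, rule ext)
    fix x y z :: "'a set \<Rightarrow> complex" and S :: "'a set"
    have "(\<Sum>T\<in>Pow S. inversion_sign T (S - T) *
            (\<Sum>U\<in>Pow T. inversion_sign U (T - U) * x U * y (T - U)) * z (S - T)) =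
          (\<Sum>(T, U)\<in>(SIGMA T:Pow S. Pow T). inversion_sign T (S - T) *
            (inversion_sign U (T - U) * x U * y (T - U)) * z (S - T))"
      by (subst sum.Sigma [symmetric]) (auto simp: sum_distrib_left sum_distrib_right)
    also have "\<dots> = (\<Sum>(U, W)\<in>(SIGMA U:Pow S. Pow (S - U)). inversion_sign U (S - U) * x U *
            (inversion_sign W (S - U - W) * y W * z (S - U - W)))"
    proof (rule sum.reindex_bij_witness[where i = "\<lambda>(U, W). (U \<union> W, U)" and j = "\<lambda>(T, U). (U, T - U)"],
        goal_cases)
      case (5 p)
      then obtain T U where p: "p = (T, U)" and TU: "U \<subseteq> T" "T \<subseteq> S" by auto
      have e1: "S - U - (T - U) = S - T" using TU by auto
      have e2: "inversions T (S - T) = inversions U (S - T) + inversions (T - U) (S - T)"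
        using inversions_Un_left[of U "T - U" "S - T"] TU by (simp add: Un_absorb1)
      have e3: "inversions U (S - U) = inversions U (T - U) + inversions U (S - T)"
      proof -
        have "S - U = (T - U) \<union> (S - T)" using TU by auto
        then show ?thesis using inversions_Un_right[of "T - U" "S - T" U] by auto
      qed
      have "inversion_sign T (S - T) * inversion_sign U (T - U) =
          inversion_sign U (S - U) * inversion_sign (T - U) (S - T)"
        by (simp add: inversion_sign_def e2 e3 power_add)
      then show ?case by (simp add: p e1 algebra_simps)
    qed auto
    also have "\<dots> = (\<Sum>U\<in>Pow S. inversion_sign U (S - U) * x U *
            (\<Sum>W\<in>Pow (S - U). inversion_sign W (S - U - W) * y W * z (S - U - W)))"
      by (subst sum.Sigma [symmetric]) (auto simp: sum_distrib_left)
    finally show "(\<Sum>T\<in>Pow S. inversion_sign T (S - T) *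
            (\<Sum>U\<in>Pow T. inversion_sign U (T - U) * x U * y (T - U)) * z (S - T)) =
        (\<Sum>U\<in>Pow S. inversion_sign U (S - U) * x U *
            (\<Sum>W\<in>Pow (S - U). inversion_sign W (S - U - W) * y W * z (S - U - W)))" .
  qed
  show "1 * a = a"
  proof (transfer, rule ext)
    fix x :: "'a set \<Rightarrow> complex" and S :: "'a set"
    have "(\<Sum>T\<in>Pow S. inversion_sign T (S - T) * (if T = {} then 1 else 0) * x (S - T)) =
        (\<Sum>T\<in>Pow S. if T = {} then x S else 0)"
      by (rule sum.cong) (auto simp: inversion_sign_def)
    then show "(\<Sum>T\<in>Pow S. inversion_sign T (S - T) * (if T = {} then 1 else 0) * x (S - T)) = x S"
      by simp
  qed
  show "a * 1 = a"
  proof (transfer, rule ext)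
    fix x :: "'a set \<Rightarrow> complex" and S :: "'a set"
    have "(\<Sum>T\<in>Pow S. inversion_sign T (S - T) * x T * (if S - T = {} then 1 else 0)) =
        (\<Sum>T\<in>Pow S. if T = S then x S else 0)"
      by (rule sum.cong) (auto simp: inversion_sign_def Diff_eq_empty_iff)
    then show "(\<Sum>T\<in>Pow S. inversion_sign T (S - T) * x T * (if S - T = {} then 1 else 0)) = x S"
      by simp
  qed
  show "(a + b) * c = a * c + b * c"
    by (transfer, rule ext) (simp add: algebra_simps sum.distrib)
  show "a * (b + c) = a * b + a * c"
    by (transfer, rule ext) (simp add: algebra_simps sum.distrib)
  show "(0::'a grassmann) \<noteq> 1"
    by transfer (auto dest: fun_cong[where x = "{}"])
qed (transfer; auto simp: algebra_simps)+

end

lift_definition gconst :: "complex \<Rightarrow> 'q::finite grassmann" is "\<lambda>c S. if S = {} then c else 0" .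

lift_definition theta :: "'q::finite \<Rightarrow> 'q grassmann" is "\<lambda>a S. if S = {a} then 1 else 0" .

definition body :: "'q::finite grassmann \<Rightarrow> complex" where
  "body x = gcoeff x {}"

definition soul :: "'q::finite grassmann \<Rightarrow> 'q grassmann" where
  "soul x = x - gconst (body x)"

definition even_element :: "'q::finite grassmann \<Rightarrow> bool" where
  "even_element x \<longleftrightarrow> (\<forall>S. odd (card S) \<longrightarrow> gcoeff x S = 0)"

definition odd_element :: "'q::finite grassmann \<Rightarrow> bool" where
  "odd_element x \<longleftrightarrow> (\<forall>S. even (card S) \<longrightarrow> gcoeff x S = 0)"

text \<open>The two-sided inverse of an invertible element.\<close>

definition ginverse :: "'q::finite grassmann \<Rightarrow> 'q grassmann" where
  "ginverse x = (THE y. x * y = 1 \<and> y * x = 1)"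

text \<open>
  The even part of the Grassmann algebra is commutative. It is made into a type so that
  determinants of matrices with even entries are the determinants of the library.
\<close>

lemma even_element_0: "even_element 0"
  by (simp add: even_element_def zero_grassmann.rep_eq)

lemma even_element_1: "even_element 1"
  by (simp add: even_element_def one_grassmann.rep_eq)

lemma even_element_add: "even_element x \<Longrightarrow> even_element y \<Longrightarrow> even_element (x + y)"
  by (simp add: even_element_def plus_grassmann.rep_eq)

lemma even_element_diff: "even_element x \<Longrightarrow> even_element y \<Longrightarrow> even_element (x - y)"
  by (simp add: even_element_def minus_grassmann.rep_eq)

lemma even_element_uminus: "even_element x \<Longrightarrow> even_element (- x)"
  by (simp add: even_element_def uminus_grassmann.rep_eq)

lemma even_element_mult:
  assumes "even_element x" "even_element y"
  shows "even_element (x * y)"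
  unfolding even_element_def times_grassmann.rep_eq
proof (intro allI impI sum.neutral ballI)
  fix S T :: "'a set" assume "odd (card S)" "T \<in> Pow S"
  then have "odd (card T) \<or> odd (card (S - T))"
    using card_Un_disjoint[of T "S - T"] by (auto simp: Un_absorb1)
  then show "inversion_sign T (S - T) * gcoeff x T * gcoeff y (S - T) = 0"
    using assms by (auto simp: even_element_def)
qed

lemma even_element_commute:
  assumes "even_element x" "even_element y"
  shows "x * y = y * x"
proof -
  have "gcoeff (x * y) S = gcoeff (y * x) S" for S
    unfolding times_grassmann.rep_eq
  proof (rule sum.reindex_bij_witness[where i = "\<lambda>T. S - T" and j = "\<lambda>T. S - T"], goal_cases)
    case (5 T)
    then have [simp]: "S - (S - T) = T" by auto
    show ?case
    proof (cases "odd (card T)")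
      case True
      then show ?thesis using assms by (simp add: even_element_def)
    next
      case False
      have "even (inversions T (S - T) + inversions (S - T) T)"
        using False by (subst inversions_swap) auto
      then have "inversion_sign T (S - T) = inversion_sign (S - T) T"
        unfolding inversion_sign_def by (auto simp: uminus_power_if)
      then show ?thesis by simp
    qed
  qed auto
  then have "gcoeff (x * y) = gcoeff (y * x)" by (rule ext)
  then show ?thesis by (simp only: gcoeff_inject)
qed

typedef 'q even_grassmann = "{x :: 'q::finite grassmann. even_element x}"
  morphisms of_even Even_grassmann
  by (auto intro: even_element_0)

setup_lifting type_definition_even_grassmann

instantiation even_grassmann :: (finite) comm_ring_1
begin

lift_definition zero_even_grassmann :: "'a even_grassmann" is 0 by (rule even_element_0)
lift_definition one_even_grassmann :: "'a even_grassmann" is 1 by (rule even_element_1)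
lift_definition plus_even_grassmann :: "'a even_grassmann \<Rightarrow> 'a even_grassmann \<Rightarrow> 'a even_grassmann"
  is "(+)" by (rule even_element_add)
lift_definition minus_even_grassmann :: "'a even_grassmann \<Rightarrow> 'a even_grassmann \<Rightarrow> 'a even_grassmann"
  is "(-)" by (rule even_element_diff)
lift_definition uminus_even_grassmann :: "'a even_grassmann \<Rightarrow> 'a even_grassmann"
  is uminus by (rule even_element_uminus)
lift_definition times_even_grassmann :: "'a even_grassmann \<Rightarrow> 'a even_grassmann \<Rightarrow> 'a even_grassmann"
  is "(*)" by (rule even_element_mult)

instance
  by standard (transfer; simp add: algebra_simps even_element_commute)+

end

lift_definition to_even :: "'q::finite grassmann \<Rightarrow> 'q even_grassmann"
  is "\<lambda>x. Grassmann (\<lambda>S. if even (card S) then gcoeff x S else 0)"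
  by (simp add: even_element_def Grassmann_inverse)

section \<open>The Berezinian\<close>

text \<open>
  A supermatrix has index type \<open>'p + 'q\<close>: \<open>Inl\<close> marks even, \<open>Inr\<close> odd rows and columns.
\<close>

definition super_block ::
    "('r \<Rightarrow> 'm) \<Rightarrow> ('c \<Rightarrow> 'n) \<Rightarrow> 'a ^ 'n ^ 'm \<Rightarrow> 'a ^ 'c ^ 'r" where
  "super_block \<rho> \<kappa> X = (\<chi> i j. X $ \<rho> i $ \<kappa> j)"

text \<open>Determinant of a square matrix all of whose entries are even.\<close>

definition even_det :: "'q::finite grassmann ^ 'n ^ 'n \<Rightarrow> 'q grassmann" where
  "even_det X = of_even (det (\<chi> i j. to_even (X $ i $ j)))"

definition Ber :: "'g::finite grassmann ^ ('p::finite + 'q::finite) ^ ('p + 'q) \<Rightarrow> 'g grassmann" where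
  "Ber X =
    (let A = super_block Inl Inl X; B = super_block Inl Inr X;
         C = super_block Inr Inl X; D = super_block Inr Inr X
     in even_det A * ginverse (even_det (D - C ** matrix_inv A ** B)))"

section \<open>Superfunctions\<close>

text \<open>
  Coefficients are functions of \<open>z \<in> \<complex>\<^sup>p\<close>; a superfunction on an open \<open>U \<subseteq> \<complex>\<^sup>p\<close> is a Grassmann valued
  function with holomorphic coefficients, that is, an element of \<open>\<O>(U) \<otimes> \<Lambda>(\<theta>\<^sub>a)\<close>.
  It is normalised to vanish outside \<open>U\<close>, so that equality of functions is equality on \<open>U\<close>.
\<close>

definition holomorphic_several :: "(complex ^ 'p::finite \<Rightarrow> complex) \<Rightarrow> (complex ^ 'p) set \<Rightarrow> bool" where
  "holomorphic_several f U \<longleftrightarrow>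
    (\<forall>z\<in>U. \<exists>D. (f has_derivative D) (at z) \<and> (\<forall>c v. D (c *s v) = c * D v))"

definition super_holomorphic ::
    "(complex ^ 'p::finite \<Rightarrow> 'q::finite grassmann) \<Rightarrow> (complex ^ 'p) set \<Rightarrow> bool" where
  "super_holomorphic F U \<longleftrightarrow> (\<forall>S. holomorphic_several (\<lambda>z. gcoeff (F z) S) U)"

definition superfunctions ::
    "(complex ^ 'p::finite) set \<Rightarrow> (complex ^ 'p \<Rightarrow> 'q::finite grassmann) set" where
  "superfunctions U = {F. super_holomorphic F U \<and> (\<forall>z. z \<notin> U \<longrightarrow> F z = 0)}"

definition partial :: "'p::finite \<Rightarrow> (complex ^ 'p \<Rightarrow> complex) \<Rightarrow> complex ^ 'p \<Rightarrow> complex" where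
  "partial k f z = deriv (\<lambda>t. f (z + axis k t)) 0"

definition even_partial ::
    "'p::finite \<Rightarrow> (complex ^ 'p \<Rightarrow> 'q::finite grassmann) \<Rightarrow> complex ^ 'p \<Rightarrow> 'q grassmann" where
  "even_partial k F z = Grassmann (\<lambda>S. partial k (\<lambda>u. gcoeff (F u) S) z)"

text \<open>
  Left derivative: \<open>\<partial>/\<partial>\<theta>\<^sub>a (\<theta>\<^sub>a \<theta>\<^sub>S) = \<theta>\<^sub>S\<close> for \<open>a \<notin> S\<close>.
\<close>

definition odd_partial ::
    "'q::finite \<Rightarrow> (complex ^ 'p::finite \<Rightarrow> 'q grassmann) \<Rightarrow> complex ^ 'p \<Rightarrow> 'q grassmann" where
  "odd_partial a F z =
    Grassmann (\<lambda>S. if a \<in> S then 0 else inversion_sign {a} S * gcoeff (F z) (insert a S))"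

text \<open>
  \<open>grassmann_extension f w\<close> is \<open>f(w)\<close> for even Grassmann elements \<open>w\<^sub>k = b\<^sub>k + s\<^sub>k\<close> (body plus
  nilpotent soul), given by the Taylor expansion
  \<open>f(b + s) = \<Sum>\<^sub>m 1/m! \<Sum>\<^bsub>k1,\<dots>,km\<^esub> (\<partial>\<^bsub>k1\<^esub> \<cdots> \<partial>\<^bsub>km\<^esub> f)(b) s\<^bsub>k1\<^esub> \<cdots> s\<^bsub>km\<^esub>\<close>.
  Products of more than \<open>CARD('q)\<close> souls vanish, hence the bound on \<open>m\<close>.
\<close>

definition grassmann_extension ::
    "(complex ^ 'p::finite \<Rightarrow> complex) \<Rightarrow> 'q::finite grassmann ^ 'p \<Rightarrow> 'q grassmann" where
  "grassmann_extension f w =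
    (\<Sum>ks | length ks \<le> CARD('q).
       gconst (foldr partial ks f (\<chi> k. body (w $ k)) / fact (length ks)) *
       prod_list (map (\<lambda>k. soul (w $ k)) ks))"

definition increasing_list :: "'q::finite set \<Rightarrow> 'q list" where
  "increasing_list S = map from_nat (sorted_list_of_set (to_nat ` S))"

text \<open>
  The pullback \<open>F(w, \<eta>) = \<Sum>\<^sub>S F\<^sub>S(w) \<eta>\<^sub>S\<close> of \<open>F = \<Sum>\<^sub>S F\<^sub>S \<theta>\<^sub>S\<close> along a morphism of superdomains given
  by its even components \<open>w\<close> and its odd components \<open>\<eta>\<close>.
\<close>

definition pullback ::
    "(complex ^ 'p::finite \<Rightarrow> 'q::finite grassmann ^ 'p) \<Rightarrow> (complex ^ 'p \<Rightarrow> 'q grassmann ^ 'q) \<Rightarrow>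
     (complex ^ 'p \<Rightarrow> 'q grassmann) \<Rightarrow> complex ^ 'p \<Rightarrow> 'q grassmann" where
  "pullback w \<eta> F z =
    (\<Sum>S\<in>UNIV. grassmann_extension (\<lambda>u. gcoeff (F u) S) (w z) *
       prod_list (map (\<lambda>a. \<eta> z $ a) (increasing_list S)))"

text \<open>
  The super Jacobian of \<open>(z, \<theta>) \<mapsto> (w, \<eta>)\<close> has rows indexed by the source and columns by the target
  coordinates, so that \<open>d(w, \<eta>) = d(z, \<theta>) \<cdot> J\<close>. With left derivatives this arrangement obeys the
  chain rule without signs, and \<open>Ber\<close> of it is a cocycle.
\<close>

definition super_jacobian ::
    "(complex ^ 'p::finite \<Rightarrow> 'q::finite grassmann ^ 'p) \<Rightarrow> (complex ^ 'p \<Rightarrow> 'q grassmann ^ 'q) \<Rightarrow>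
     complex ^ 'p \<Rightarrow> 'q grassmann ^ ('p + 'q) ^ ('p + 'q)" where
  "super_jacobian w \<eta> z =
    (\<chi> r c.
      let F = (\<lambda>u. case c of Inl l \<Rightarrow> w u $ l | Inr b \<Rightarrow> \<eta> u $ b)
      in case r of Inl k \<Rightarrow> even_partial k F z | Inr a \<Rightarrow> odd_partial a F z)"

section \<open>Complex supermanifolds\<close>

text \<open>
  A supermanifold of dimension \<open>CARD('p)|CARD('q)\<close>, given as a topological space covered by charts
  and glued as a locally ringed space by morphisms of superdomains: \<open>even_trans A i j\<close> and
  \<open>odd_trans A i j\<close> express the coordinates of chart \<open>j\<close> as superfunctions of the coordinates of
  chart \<open>i\<close>, and are relevant only on the image of the overlap in chart \<open>i\<close>. A morphism of
  superdomains is determined by the pullbacks of the coordinates, so the cocycle condition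
  \<open>\<phi>\<^sub>j\<^sub>l \<circ> \<phi>\<^sub>i\<^sub>j = \<phi>\<^sub>i\<^sub>l\<close> is stated on these.
\<close>

record ('x, 'i, 'p, 'q) super_atlas =
  space_of :: "'x topology"
  charts :: "'i set"
  chart_dom :: "'i \<Rightarrow> 'x set"
  chart_map :: "'i \<Rightarrow> 'x \<Rightarrow> complex ^ 'p"
  even_trans :: "'i \<Rightarrow> 'i \<Rightarrow> complex ^ 'p \<Rightarrow> 'q grassmann ^ 'p"
  odd_trans :: "'i \<Rightarrow> 'i \<Rightarrow> complex ^ 'p \<Rightarrow> 'q grassmann ^ 'q"

definition complex_supermanifold :: "('x, 'i, 'p::finite, 'q::finite) super_atlas \<Rightarrow> bool" where
  "complex_supermanifold A \<longleftrightarrow>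
    Hausdorff_space (space_of A) \<and> second_countable (space_of A) \<and>
    (\<Union>i\<in>charts A. chart_dom A i) = topspace (space_of A) \<and>
    (\<forall>i\<in>charts A.
       openin (space_of A) (chart_dom A i) \<and>
       open (chart_map A i ` chart_dom A i) \<and>
       homeomorphic_map (subtopology (space_of A) (chart_dom A i))
         (top_of_set (chart_map A i ` chart_dom A i)) (chart_map A i)) \<and>
    (\<forall>i\<in>charts A. \<forall>j\<in>charts A.
       (\<forall>k. super_holomorphic (\<lambda>z. even_trans A i j z $ k)
              (chart_map A i ` (chart_dom A i \<inter> chart_dom A j))) \<and>
       (\<forall>a. super_holomorphic (\<lambda>z. odd_trans A i j z $ a)
              (chart_map A i ` (chart_dom A i \<inter> chart_dom A j))) \<and>
       (\<forall>x\<in>chart_dom A i \<inter> chart_dom A j.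
          (\<forall>k. even_element (even_trans A i j (chart_map A i x) $ k) \<and>
               body (even_trans A i j (chart_map A i x) $ k) = chart_map A j x $ k) \<and>
          (\<forall>a. odd_element (odd_trans A i j (chart_map A i x) $ a)))) \<and>
    (\<forall>i\<in>charts A. \<forall>x\<in>chart_dom A i.
       (\<forall>k. even_trans A i i (chart_map A i x) $ k = gconst (chart_map A i x $ k)) \<and>
       (\<forall>a. odd_trans A i i (chart_map A i x) $ a = theta a)) \<and>
    (\<forall>i\<in>charts A. \<forall>j\<in>charts A. \<forall>l\<in>charts A.
       \<forall>x\<in>chart_dom A i \<inter> chart_dom A j \<inter> chart_dom A l.
         (\<forall>k. pullback (even_trans A i j) (odd_trans A i j) (\<lambda>u. even_trans A j l u $ k)
                (chart_map A i x) = even_trans A i l (chart_map A i x) $ k) \<and>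
         (\<forall>a. pullback (even_trans A i j) (odd_trans A i j) (\<lambda>u. odd_trans A j l u $ a)
                (chart_map A i x) = odd_trans A i l (chart_map A i x) $ a))"

section \<open>Sheaves of modules and the Berezinian sheaf\<close>

text \<open>
  Sections over an open set \<open>V\<close> of the rank \<open>1|0\<close> sheaf of \<open>\<O>\<close>-modules with transition functions \<open>c\<close>:
  families of local superfunctions \<open>s\<^sub>i\<close>, standing for \<open>s\<^sub>i e\<^sub>i\<close> with local generators related by
  \<open>e\<^sub>j = c\<^sub>i\<^sub>j e\<^sub>i\<close>, such that \<open>s\<^sub>i = c\<^sub>i\<^sub>j \<phi>\<^sub>i\<^sub>j\<^sup>*(s\<^sub>j)\<close> on overlaps.
\<close>

type_synonym ('i, 'p, 'q) local_family = "'i \<Rightarrow> complex ^ 'p \<Rightarrow> 'q grassmann"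

definition glued_sections ::
    "('x, 'i, 'p::finite, 'q::finite) super_atlas \<Rightarrow> ('i \<Rightarrow> 'i \<Rightarrow> complex ^ 'p \<Rightarrow> 'q grassmann) \<Rightarrow>
     'x set \<Rightarrow> ('i, 'p, 'q) local_family set" where
  "glued_sections A c V =
    {s. (\<forall>i. i \<notin> charts A \<longrightarrow> s i = (\<lambda>z. 0)) \<and>
        (\<forall>i\<in>charts A. s i \<in> superfunctions (chart_map A i ` (V \<inter> chart_dom A i))) \<and>
        (\<forall>i\<in>charts A. \<forall>j\<in>charts A. \<forall>x\<in>V \<inter> chart_dom A i \<inter> chart_dom A j.
           s i (chart_map A i x) =
             c i j (chart_map A i x) *
             pullback (even_trans A i j) (odd_trans A i j) (s j) (chart_map A i x))}"

definition structure_sheaf ::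
    "('x, 'i, 'p::finite, 'q::finite) super_atlas \<Rightarrow> 'x set \<Rightarrow> ('i, 'p, 'q) local_family set" where
  "structure_sheaf A = glued_sections A (\<lambda>i j z. 1)"

definition berezinian_sheaf ::
    "('x, 'i, 'p::finite, 'q::finite) super_atlas \<Rightarrow> 'x set \<Rightarrow> ('i, 'p, 'q) local_family set" where
  "berezinian_sheaf A =
    glued_sections A (\<lambda>i j z. Ber (super_jacobian (even_trans A i j) (odd_trans A i j) z))"

definition section_add ::
    "('i, 'p, 'q::finite) local_family \<Rightarrow> ('i, 'p, 'q) local_family \<Rightarrow> ('i, 'p, 'q) local_family" where
  "section_add s t = (\<lambda>i z. s i z + t i z)"

definition section_mult ::
    "('i, 'p, 'q::finite) local_family \<Rightarrow> ('i, 'p, 'q) local_family \<Rightarrow> ('i, 'p, 'q) local_family" where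
  "section_mult f s = (\<lambda>i z. f i z * s i z)"

definition section_restrict ::
    "('x, 'i, 'p::finite, 'q::finite) super_atlas \<Rightarrow> 'x set \<Rightarrow>
     ('i, 'p, 'q) local_family \<Rightarrow> ('i, 'p, 'q) local_family" where
  "section_restrict A U s =
    (\<lambda>i z. if z \<in> chart_map A i ` (U \<inter> chart_dom A i) then s i z else 0)"

text \<open>
  Isomorphism of sheaves of \<open>\<O>\<close>-modules. As usual for \<open>\<int>\<^sub>2\<close>-graded modules, morphisms preserve parity.
\<close>

definition module_sheaf_iso ::
    "('x, 'i, 'p::finite, 'q::finite) super_atlas \<Rightarrow>
     ('x set \<Rightarrow> ('i, 'p, 'q) local_family set) \<Rightarrow> ('x set \<Rightarrow> ('i, 'p, 'q) local_family set) \<Rightarrow> bool" where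
  "module_sheaf_iso A \<F> \<G> \<longleftrightarrow>
    (\<exists>h. \<forall>V. openin (space_of A) V \<longrightarrow>
       bij_betw (h V) (\<F> V) (\<G> V) \<and>
       (\<forall>s\<in>\<F> V. \<forall>t\<in>\<F> V. h V (section_add s t) = section_add (h V s) (h V t)) \<and>
       (\<forall>f\<in>structure_sheaf A V. \<forall>s\<in>\<F> V. h V (section_mult f s) = section_mult f (h V s)) \<and>
       (\<forall>s\<in>\<F> V. ((\<forall>i z. even_element (s i z)) \<longrightarrow> (\<forall>i z. even_element (h V s i z))) \<and>
                 ((\<forall>i z. odd_element (s i z)) \<longrightarrow> (\<forall>i z. odd_element (h V s i z)))) \<and>
       (\<forall>U. openin (space_of A) U \<and> U \<subseteq> V \<longrightarrow>
          (\<forall>s\<in>\<F> V. h U (section_restrict A U s) = section_restrict A U (h V s))))"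

definition calabi_yau :: "('x, 'i, 'p::finite, 'q::finite) super_atlas \<Rightarrow> bool" where
  "calabi_yau A \<longleftrightarrow>
    complex_supermanifold A \<and> module_sheaf_iso A (berezinian_sheaf A) (structure_sheaf A)"

section \<open>Projective space\<close>

text \<open>
  Here \<open>n = CARD('n)\<close>, and \<open>'n option\<close> plays the role of the set \<open>{0, \<dots>, n}\<close> of homogeneous indices.
  Points of \<open>\<P>\<^sup>n\<close> are lines in \<open>\<complex>\<^bsup>n+1\<^esup>\<close>, with the quotient topology of \<open>\<complex>\<^bsup>n+1\<^esup> - {0}\<close>.
\<close>

definition line :: "complex ^ 'm \<Rightarrow> (complex ^ 'm) set" where
  "line v = {c *s v | c. True}"

definition projective_topology :: "(complex ^ 'm::finite) set topology" where
  "projective_topology =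
    topology (\<lambda>V. V \<subseteq> line ` (UNIV - {0}) \<and> open {v. v \<noteq> 0 \<and> line v \<in> V})"

definition projective_chart_dom :: "'m \<Rightarrow> (complex ^ 'm::finite) set set" where
  "projective_chart_dom i = {line v | v. v $ i \<noteq> 0}"

text \<open>
  \<open>chart_label i\<close> is a bijection from \<open>'n\<close> onto the indices \<open>\<ell> \<noteq> i\<close>, which label the coordinates
  \<open>z\<^bsub>\<ell>i\<^esub>\<close>, \<open>\<theta>\<^bsub>\<ell>i\<^esub>\<close> of the \<open>i\<close>-th chart. The same labelling is used for even and odd coordinates.
\<close>

definition chart_label :: "'n option \<Rightarrow> 'n \<Rightarrow> 'n option" where
  "chart_label i k = (if Some k = i then None else Some k)"

lemma inj_chart_label: "inj (chart_label i)"
  by (auto simp: inj_def chart_label_def split: if_splits)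

lemma range_chart_label: "range (chart_label i) = UNIV - {i}"
proof -
  have "l \<in> range (chart_label i)" if "l \<noteq> i" for l
  proof (cases l)
    case None
    then obtain k where "i = Some k" using \<open>l \<noteq> i\<close> by (cases i) auto
    then have "l = chart_label i k" using None by (simp add: chart_label_def)
    then show ?thesis by blast
  next
    case (Some m)
    then have "l = chart_label i m" using \<open>l \<noteq> i\<close> by (auto simp: chart_label_def)
    then show ?thesis by blast
  qed
  moreover have "chart_label i k \<noteq> i" for k
    by (auto simp: chart_label_def split: if_splits)
  ultimately show ?thesis by auto
qed

text \<open>The point \<open>[X]\<close> has coordinates \<open>z\<^bsub>\<ell>i\<^esub> = X\<^sub>\<ell> / X\<^sub>i\<close>, where the representative is scaled to \<open>X\<^sub>i = 1\<close>.\<close>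

definition projective_chart ::
    "'n option \<Rightarrow> (complex ^ ('n::finite option)) set \<Rightarrow> complex ^ 'n" where
  "projective_chart i L = (\<chi> k. (THE v. v \<in> L \<and> v $ i = 1) $ chart_label i k)"

section \<open>The \<open>\<Pi>\<close>-projective space\<close>

definition even_coord :: "'n::finite option \<Rightarrow> complex ^ 'n \<Rightarrow> 'n option \<Rightarrow> 'n grassmann" where
  "even_coord i z l = (if l = i then 1 else gconst (z $ inv (chart_label i) l))"

definition odd_coord :: "'n::finite option \<Rightarrow> 'n option \<Rightarrow> 'n grassmann" where
  "odd_coord i l = (if l = i then 0 else theta (inv (chart_label i) l))"

text \<open>The \<open>1|1 \<times> (n+1)|(n+1)\<close> supermatrix \<open>\<Z>\<^sub>i\<close> and its \<open>1|1 \<times> 1|1\<close> submatrix \<open>\<B>\<^sub>i\<^sub>j\<close>.\<close>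

definition Pi_matrix ::
    "'n::finite option \<Rightarrow> complex ^ 'n \<Rightarrow> 'n grassmann ^ ('n option + 'n option) ^ (unit + unit)" where
  "Pi_matrix i z =
    (\<chi> r c. case (r, c) of
        (Inl _, Inl l) \<Rightarrow> even_coord i z l
      | (Inl _, Inr l) \<Rightarrow> odd_coord i l
      | (Inr _, Inl l) \<Rightarrow> - odd_coord i l
      | (Inr _, Inr l) \<Rightarrow> even_coord i z l)"

definition Pi_submatrix ::
    "'n::finite option \<Rightarrow> 'n option \<Rightarrow> complex ^ 'n \<Rightarrow> 'n grassmann ^ (unit + unit) ^ (unit + unit)" where
  "Pi_submatrix i j z =
    super_block id (\<lambda>c. case c of Inl _ \<Rightarrow> Inl j | Inr _ \<Rightarrow> Inr j) (Pi_matrix i z)"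

text \<open>\<open>\<Z>\<^sub>j = \<B>\<^sub>i\<^sub>j\<^sup>-\<^sup>1 \<Z>\<^sub>i\<close>, expressed in the coordinates of the \<open>i\<close>-th chart; its first row lists \<open>z\<^bsub>\<ell>j\<^esub>\<close> and \<open>\<theta>\<^bsub>\<ell>j\<^esub>\<close>.\<close>

definition Pi_glued_matrix ::
    "'n::finite option \<Rightarrow> 'n option \<Rightarrow> complex ^ 'n \<Rightarrow>
     'n grassmann ^ ('n option + 'n option) ^ (unit + unit)" where
  "Pi_glued_matrix i j z = matrix_inv (Pi_submatrix i j z) ** Pi_matrix i z"

definition Pi_projective_space ::
    "'n::finite itself \<Rightarrow> ((complex ^ ('n option)) set, 'n option, 'n, 'n) super_atlas" where
  "Pi_projective_space _ =
    \<lparr> space_of = projective_topology,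
      charts = UNIV,
      chart_dom = projective_chart_dom,
      chart_map = projective_chart,
      even_trans = (\<lambda>i j z. \<chi> k. Pi_glued_matrix i j z $ Inl () $ Inl (chart_label j k)),
      odd_trans = (\<lambda>i j z. \<chi> k. Pi_glued_matrix i j z $ Inl () $ Inr (chart_label j k)) \<rparr>"

end

theory Submission
  imports Defs
begin

text \<open>
  The Berezinian of every change of charts of \<open>\<P>\<^sup>n\<^sub>\<Pi>\<close> is exactly \<open>1\<close>. The Berezinian sheaf and the structure
  sheaf are therefore glued by the same transition functions, they coincide, and the identity is the
  required isomorphism.

  To see why the Berezinian is \<open>1\<close>, put \<open>v = 1 / z\<^bsub>ji\<^esub>\<close>. The gluing rule \<open>\<Z>\<^sub>j = \<B>\<^sub>i\<^sub>j\<^sup>-\<^sup>1 \<Z>\<^sub>i\<close> reads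
  \<open>z\<^bsub>\<ell>j\<^esub> = v z\<^bsub>\<ell>i\<^esub> + v\<^sup>2 \<theta>\<^bsub>ji\<^esub> \<theta>\<^bsub>\<ell>i\<^esub>\<close> and \<open>\<theta>\<^bsub>\<ell>j\<^esub> = v \<theta>\<^bsub>\<ell>i\<^esub> - v\<^sup>2 z\<^bsub>\<ell>i\<^esub> \<theta>\<^bsub>ji\<^esub>\<close>. Up to nilpotents the even and
  the odd coordinates have the same Jacobian: in the diagonal blocks \<open>A\<close> and \<open>D\<close>, every row other than that
  of the coordinate with index \<open>j\<close> contains only the entry \<open>v\<close>, and that row meets the column of the
  coordinate with index \<open>i\<close> in \<open>- v\<^sup>2\<close>. The determinant of such a matrix is determined by these entries
  (\<open>det_single_permutation\<close>), so \<open>det A = det D\<close>. The nilpotent correction \<open>C A\<^sup>-\<^sup>1 B\<close> lives in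
  entries on which the determinant does not depend: \<open>C\<close> is an explicit multiple \<open>E A\<close>, and \<open>E B\<close> is
  zero except in the row of \<open>\<theta>\<^bsub>ji\<^esub>\<close>, away from the column of \<open>\<theta>\<^bsub>ij\<^esub>\<close>, mainly because \<open>\<theta>\<^bsub>ji\<^esub>\<^sup>2 = 0\<close>. This is
  \<open>Ber_transition\<close>.

  It remains to show that the charts define a supermanifold (\<open>complex_supermanifold_Pi\<close>). The substantial
  point is the cocycle condition \<open>pullback_transition\<close>. Pullbacks are Taylor expansions in nilpotent
  directions; by the iterated Leibniz rule such an expansion is a ring homomorphism
  (\<open>taylor_sum_mult\<close>, \<open>grassmann_extension_mult\<close>), so it carries the gluing rule between the charts
  \<open>j\<close> and \<open>l\<close> to the same rule for elements of the Grassmann algebra. There the cocycle condition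
  is the matrix identity \<open>(\<B>\<^sub>i\<^sub>j\<^sup>-\<^sup>1 \<B>\<^sub>i\<^sub>l)\<^sup>-\<^sup>1 \<B>\<^sub>i\<^sub>j\<^sup>-\<^sup>1 \<Z>\<^sub>i = \<B>\<^sub>i\<^sub>l\<^sup>-\<^sup>1 \<Z>\<^sub>i\<close>.

  Projective space is Hausdorff since a line is determined by the orthogonal projection onto it, and
  second countable since the quotient map from \<open>\<complex>\<^bsup>n+1\<^esup> - {0}\<close> is open.
\<close>

section \<open>Sign rules in the Grassmann algebra\<close>

lemma grassmann_eqI: "(\<And>S. gcoeff x S = gcoeff y S) \<Longrightarrow> x = y"
  by (metis gcoeff_inject ext)

lemma gcoeff_Grassmann [simp]: "gcoeff (Grassmann f) = f"
  by (simp add: Grassmann_inverse)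

lemma gcoeff_gconst_mult [simp]: "gcoeff (gconst c * x) S = c * gcoeff x S"
proof -
  have "gcoeff (gconst c * x) S = (\<Sum>T\<in>Pow S. if T = {} then c * gcoeff x S else 0)"
    unfolding times_grassmann.rep_eq gconst.rep_eq
    by (rule sum.cong) (auto simp: inversion_sign_def)
  then show ?thesis by simp
qed

lemma gconst_0 [simp]: "gconst 0 = 0"
  by (transfer, rule ext) simp

lemma gconst_1 [simp]: "gconst 1 = 1"
  by (transfer, rule ext) simp

lemma gconst_add: "gconst (a + b) = gconst a + gconst b"
  by (transfer, rule ext) simp

lemma gconst_minus: "gconst (- a) = - gconst a"
  by (transfer, rule ext) simp

lemma gconst_mult: "gconst (a * b) = gconst a * gconst b"
  by (rule grassmann_eqI) (simp add: gconst.rep_eq)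

lemma even_gconst [simp]: "even_element (gconst c)"
  by (simp add: even_element_def gconst.rep_eq)

lemma odd_theta [simp]: "odd_element (theta a)"
  by (auto simp: odd_element_def theta.rep_eq)

lemma odd_0 [simp]: "odd_element 0"
  by (simp add: odd_element_def zero_grassmann.rep_eq)

lemma odd_add: "odd_element x \<Longrightarrow> odd_element y \<Longrightarrow> odd_element (x + y)"
  by (simp add: odd_element_def plus_grassmann.rep_eq)

lemma card_parity_split:
  assumes "T \<subseteq> (S :: 'q::finite set)"
  shows "even (card S) \<longleftrightarrow> (even (card T) \<longleftrightarrow> even (card (S - T)))"
proof -
  have "card S = card T + card (S - T)"
    using assms card_Un_disjoint[of T "S - T"] by (auto simp: Un_absorb1)
  then show ?thesis by auto
qed

lemma even_mult_odd:
  assumes "even_element x" "odd_element y"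
  shows "odd_element (x * y)"
  unfolding odd_element_def times_grassmann.rep_eq
proof (intro allI impI sum.neutral ballI)
  fix S T :: "'a set" assume "even (card S)" "T \<in> Pow S"
  then have "odd (card T) \<or> even (card (S - T))"
    using card_parity_split[of T S] by auto
  then show "inversion_sign T (S - T) * gcoeff x T * gcoeff y (S - T) = 0"
    using assms by (auto simp: even_element_def odd_element_def)
qed

lemma odd_mult_odd:
  assumes "odd_element x" "odd_element y"
  shows "even_element (x * y)"
  unfolding even_element_def times_grassmann.rep_eq
proof (intro allI impI sum.neutral ballI)
  fix S T :: "'a set" assume "odd (card S)" "T \<in> Pow S"
  then have "even (card T) \<or> even (card (S - T))"
    using card_parity_split[of T S] by auto
  then show "inversion_sign T (S - T) * gcoeff x T * gcoeff y (S - T) = 0"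
    using assms by (auto simp: odd_element_def)
qed

lemma inversion_sign_swap:
  assumes "A \<inter> B = {}"
  shows "inversion_sign A B = (-1) ^ (card A * card B) * inversion_sign B A"
proof -
  have "inversion_sign A B * inversion_sign B A = (-1) ^ (card A * card B)"
    unfolding inversion_sign_def using inversions_swap[OF assms] by (simp flip: power_add)
  moreover have "inversion_sign B A * inversion_sign B A = 1"
    unfolding inversion_sign_def by (simp flip: power_mult_distrib)
  ultimately show ?thesis by (metis mult.assoc mult.right_neutral)
qed

text \<open>
  Interchanging the two factors of a monomial \<open>\<theta>\<^sub>T \<theta>\<^bsub>S-T\<^esub>\<close> costs the sign \<open>(-1)\<^bsup>|T| |S-T|\<^esup>\<close>. For even
  or odd factors this sign is the same for all monomials that occur, so this single identity gives both
  commutation rules below.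
\<close>

lemma grassmann_mult_reflect:
  "gcoeff (y * x) S = (\<Sum>T\<in>Pow S. (-1) ^ (card T * card (S - T)) *
      (inversion_sign T (S - T) * gcoeff x T * gcoeff y (S - T)))"
  unfolding times_grassmann.rep_eq
proof (rule sum.reindex_bij_witness[where i = "\<lambda>T. S - T" and j = "\<lambda>T. S - T"], goal_cases)
  case (5 T)
  then have [simp]: "S - (S - T) = T" by auto
  have "inversion_sign T (S - T) = (-1) ^ (card T * card (S - T)) * inversion_sign (S - T) T"
    by (rule inversion_sign_swap) auto
  then show ?case by (simp add: mult_ac)
qed auto

lemma even_central:
  assumes "even_element x"
  shows "x * y = y * x"
proof (rule grassmann_eqI)
  fix S
  show "gcoeff (x * y) S = gcoeff (y * x) S"
    unfolding grassmann_mult_reflect[of y x] times_grassmann.rep_eq[of x y]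
    by (rule sum.cong) (use assms in \<open>auto simp: even_element_def minus_one_power_iff\<close>)
qed

lemma odd_anticommute:
  assumes "odd_element x" "odd_element y"
  shows "x * y = - (y * x)"
proof (rule grassmann_eqI)
  fix S
  show "gcoeff (x * y) S = gcoeff (- (y * x)) S"
    unfolding uminus_grassmann.rep_eq grassmann_mult_reflect[of y x]
      times_grassmann.rep_eq[of x y] sum_negf [symmetric]
    by (rule sum.cong) (use assms in \<open>auto simp: odd_element_def minus_one_power_iff\<close>)
qed

text \<open>
  Anticommutation gives only \<open>x\<^sup>2 = - x\<^sup>2\<close>; the square vanishes since the coefficients are complex
  numbers.
\<close>

lemma odd_square:
  assumes "odd_element x"
  shows "x * x = 0"
proof (rule grassmann_eqI)
  fix S
  have "gcoeff (x * x) S = - gcoeff (x * x) S"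
    using odd_anticommute[OF assms assms] by (metis uminus_grassmann.rep_eq)
  then show "gcoeff (x * x) S = gcoeff 0 S" by (simp add: zero_grassmann.rep_eq)
qed

lemma gconst_commute: "x * gconst c = gconst c * x"
  by (rule even_central[symmetric]) simp

section \<open>Nilpotency of souls\<close>

text \<open>
  The filtration by powers of the ideal generated by the \<open>\<theta>\<^sub>a\<close>. It is multiplicative and stops after
  degree \<open>CARD('q)\<close>, which makes the Taylor series of the pullback finite.
\<close>

definition vanishes_below :: "nat \<Rightarrow> 'q::finite grassmann \<Rightarrow> bool" where
  "vanishes_below r x \<longleftrightarrow> (\<forall>S. card S < r \<longrightarrow> gcoeff x S = 0)"

lemma vanishes_below_mult:
  assumes "vanishes_below r x" "vanishes_below s y"
  shows "vanishes_below (r + s) (x * y)"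
  unfolding vanishes_below_def times_grassmann.rep_eq
proof (intro allI impI sum.neutral ballI)
  fix S T :: "'a set" assume *: "card S < r + s" "T \<in> Pow S"
  then have "card S = card T + card (S - T)"
    using card_Un_disjoint[of T "S - T"] by (auto simp: Un_absorb1)
  with * have "card T < r \<or> card (S - T) < s" by linarith
  then show "inversion_sign T (S - T) * gcoeff x T * gcoeff y (S - T) = 0"
    using assms by (auto simp: vanishes_below_def)
qed

lemma vanishes_below_soul: "vanishes_below 1 (soul x)"
  by (auto simp: vanishes_below_def soul_def minus_grassmann.rep_eq gconst.rep_eq body_def)

lemma prod_list_souls_eq_0:
  fixes w :: "'k \<Rightarrow> 'q::finite grassmann"
  assumes "length ks > CARD('q)"
  shows "prod_list (map (\<lambda>k. soul (w k)) ks) = 0"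
proof -
  have "vanishes_below (length ks) (prod_list (map (\<lambda>k. soul (w k)) ks))"
  proof (induction ks)
    case (Cons k ks)
    then show ?case using vanishes_below_mult[OF vanishes_below_soul] by fastforce
  qed (simp add: vanishes_below_def)
  moreover have "card S \<le> CARD('q)" for S :: "'q set"
    by (rule card_mono) auto
  ultimately show ?thesis using assms
    by (intro grassmann_eqI) (auto simp: vanishes_below_def zero_grassmann.rep_eq intro: le_less_trans)
qed

section \<open>Iterated partial derivatives\<close>

lemma axis_zero [simp]: "axis k (0 :: 'a::zero) = 0"
  by (simp add: vec_eq_iff axis_def)

text \<open>
  Differentiability is required along the coordinate axes, because these are the derivatives that enter the
  Taylor expansion which defines a pullback. Counting the order of differentiability makes the product and quotient rules preserve
  smoothness by induction: the derivative of a product or reciprocal is a polynomial in functions of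
  order one less.
\<close>

primrec smooth_order :: "nat \<Rightarrow> (complex ^ 'p::finite) set \<Rightarrow> (complex ^ 'p \<Rightarrow> complex) \<Rightarrow> bool" where
  "smooth_order 0 U f \<longleftrightarrow> True"
| "smooth_order (Suc m) U f \<longleftrightarrow>
    (\<forall>k. \<forall>z\<in>U. (\<lambda>t. f (z + axis k t)) field_differentiable at 0) \<and>
    (\<forall>k. smooth_order m U (partial k f))"

definition smooth :: "(complex ^ 'p::finite) set \<Rightarrow> (complex ^ 'p \<Rightarrow> complex) \<Rightarrow> bool" where
  "smooth U f \<longleftrightarrow> (\<forall>m. smooth_order m U f)"

lemma eventually_in_line:
  fixes z :: "complex ^ 'p::finite"
  assumes "open U" "z \<in> U"
  shows "eventually (\<lambda>t. z + axis k t \<in> U) (nhds 0)"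
proof -
  have "continuous_on UNIV (\<lambda>t::complex. if i = k then t else 0)" for i
    by (cases "i = k") auto
  then have "continuous_on UNIV (\<lambda>t::complex. z + axis k t)"
    unfolding axis_def by (intro continuous_intros)
  then have "open ((\<lambda>t::complex. z + axis k t) -` U)"
    using assms(1) by (simp add: open_vimage)
  moreover have "0 \<in> (\<lambda>t::complex. z + axis k t) -` U" using assms(2) by simp
  ultimately show ?thesis
    unfolding eventually_nhds by blast
qed

lemma partial_cong:
  assumes "open U" "\<And>z. z \<in> U \<Longrightarrow> f z = g z" "z \<in> U"
  shows "partial k f z = partial k g z"
  unfolding partial_def
  by (rule deriv_cong_ev) (auto intro: eventually_mono[OF eventually_in_line[OF assms(1,3)]] assms(2))

text \<open>
  Iterated derivatives depend only on the germ. This allows superfunctions to be replaced by explicit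
  formulas that hold only on the overlap of two charts.
\<close>

lemma foldr_partial_cong:
  assumes "open U" "\<And>z. z \<in> U \<Longrightarrow> f z = g z" "z \<in> U"
  shows "foldr partial ks f z = foldr partial ks g z"
  using assms(3)
proof (induction ks arbitrary: z)
  case (Cons k ks)
  have "partial k (foldr partial ks f) z = partial k (foldr partial ks g) z"
    by (rule partial_cong[OF assms(1)]) (use Cons in auto)
  then show ?case by simp
qed (use assms(2) in simp)

lemma differentiable_line_cong:
  fixes f g :: "complex ^ 'p::finite \<Rightarrow> complex"
  assumes "open U" "\<And>z. z \<in> U \<Longrightarrow> f z = g z" "z \<in> U"
    and "(\<lambda>t. f (z + axis k t)) field_differentiable at 0"
  shows "(\<lambda>t. g (z + axis k t)) field_differentiable at 0"
proof -
  have ev: "eventually (\<lambda>t. f (z + axis k t) = g (z + axis k t)) (nhds 0)"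
    using eventually_in_line[OF assms(1,3)] by eventually_elim (auto intro: assms(2))
  show ?thesis
    using assms(4) unfolding field_differentiable_def
    using DERIV_cong_ev[OF refl ev refl] by blast
qed

lemma smooth_order_cong:
  assumes "open U" "\<And>z. z \<in> U \<Longrightarrow> f z = g z" "smooth_order m U f"
  shows "smooth_order m U g"
  using assms(2,3)
proof (induction m arbitrary: f g)
  case (Suc m)
  have "smooth_order m U (partial k g)" for k
    by (rule Suc.IH[of "partial k f"])
      (use Suc.prems in \<open>auto intro: partial_cong[OF assms(1)]\<close>)
  moreover have "(\<lambda>t. g (z + axis k t)) field_differentiable at 0" if "z \<in> U" for z k
    by (rule differentiable_line_cong[OF assms(1), where f = f]) (use Suc.prems that in auto)
  ultimately show ?case by simp
qed simp

lemma smooth_order_Suc_D: "smooth_order (Suc m) U f \<Longrightarrow> smooth_order m U f"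
proof (induction m arbitrary: f)
  case (Suc m)
  then show ?case by (metis smooth_order.simps(2))
qed simp

lemma partial_const [simp]: "partial k (\<lambda>_. c) = (\<lambda>_. 0)"
  by (simp add: partial_def fun_eq_iff)

lemma partial_component [simp]: "partial k (\<lambda>z. z $ l) = (\<lambda>_. if k = l then 1 else 0)"
proof
  fix z :: "complex ^ 'a"
  have "(\<lambda>t. (z + axis k t) $ l) = (if k = l then (\<lambda>t. z $ l + t) else (\<lambda>t. z $ l))"
    by (auto simp: axis_def)
  then show "partial k (\<lambda>z. z $ l) z = (if k = l then 1 else 0)"
    by (simp add: partial_def)
qed

lemma partial_add:
  assumes "(\<lambda>t. f (z + axis k t)) field_differentiable at 0" "(\<lambda>t. g (z + axis k t)) field_differentiable at 0"
  shows "partial k (\<lambda>u. f u + g u) z = partial k f z + partial k g z"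
  unfolding partial_def using deriv_add[OF assms] by simp

lemma partial_mult:
  assumes "(\<lambda>t. f (z + axis k t)) field_differentiable at 0" "(\<lambda>t. g (z + axis k t)) field_differentiable at 0"
  shows "partial k (\<lambda>u. f u * g u) z = partial k f z * g z + f z * partial k g z"
  unfolding partial_def using deriv_mult[OF assms] by (simp add: algebra_simps)

lemma partial_inverse:
  assumes "(\<lambda>t. f (z + axis k t)) field_differentiable at 0" "f z \<noteq> 0"
  shows "partial k (\<lambda>u. inverse (f u)) z = - partial k f z * (inverse (f z) * inverse (f z))"
  unfolding partial_def using deriv_inverse[OF assms(1)] assms(2)
  by (simp add: power2_eq_square divide_inverse del: deriv_inverse)

lemma smooth_const: "smooth U (\<lambda>_. c)"
proof -
  have "smooth_order m U (\<lambda>_. c)" for m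
    by (induction m arbitrary: c) auto
  then show ?thesis by (simp add: smooth_def)
qed

lemma smooth_component: "smooth U (\<lambda>z. z $ l)"
proof -
  have "smooth_order m U (\<lambda>z. z $ l)" for m
  proof (cases m)
    case (Suc m')
    have "(\<lambda>t. (z + axis k t) $ l) field_differentiable at 0" for k and z :: "complex ^ 'a"
    proof -
      have "(\<lambda>t. (z + axis k t) $ l) = (if k = l then (\<lambda>t. z $ l + t) else (\<lambda>t. z $ l))"
        by (auto simp: axis_def)
      then show ?thesis by (auto intro: derivative_intros)
    qed
    then show ?thesis using smooth_const[of U] unfolding smooth_def by (simp add: Suc del: vector_add_component)
  qed simp
  then show ?thesis by (simp add: smooth_def)
qed

lemma smooth_order_add:
  assumes "open U" "smooth_order m U f" "smooth_order m U g"
  shows "smooth_order m U (\<lambda>z. f z + g z)"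
  using assms(2,3)
proof (induction m arbitrary: f g)
  case (Suc m)
  have "smooth_order m U (partial k (\<lambda>z. f z + g z))" for k
    by (rule smooth_order_cong[OF assms(1), where f = "\<lambda>z. partial k f z + partial k g z"])
      (use Suc in \<open>auto simp: partial_add\<close>)
  then show ?case using Suc.prems by (auto intro: field_differentiable_add)
qed simp

lemma smooth_order_mult:
  assumes "open U" "smooth_order m U f" "smooth_order m U g"
  shows "smooth_order m U (\<lambda>z. f z * g z)"
  using assms(2,3)
proof (induction m arbitrary: f g)
  case (Suc m)
  have "smooth_order m U (partial k (\<lambda>z. f z * g z))" for k
  proof (rule smooth_order_cong[OF assms(1)])
    show "smooth_order m U (\<lambda>z. partial k f z * g z + f z * partial k g z)"
      by (intro smooth_order_add assms(1) Suc.IH Suc.prems[THEN smooth_order_Suc_D]) (use Suc.prems in simp_all)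
  qed (use Suc.prems in \<open>auto simp: partial_mult\<close>)
  then show ?case using Suc.prems by (auto intro: field_differentiable_mult)
qed simp

lemma smooth_order_inverse:
  assumes "open U" "smooth_order m U f" "\<And>z. z \<in> U \<Longrightarrow> f z \<noteq> 0"
  shows "smooth_order m U (\<lambda>z. inverse (f z))"
  using assms(2)
proof (induction m)
  case (Suc m)
  have inv: "smooth_order m U (\<lambda>z. inverse (f z))"
    using Suc smooth_order_Suc_D by blast
  have "smooth_order m U (partial k (\<lambda>z. inverse (f z)))" for k
  proof (rule smooth_order_cong[OF assms(1)])
    show "smooth_order m U (\<lambda>z. partial k f z * (- 1 * (inverse (f z) * inverse (f z))))"
      using Suc.prems smooth_const[of U "-1"] inv
      by (intro smooth_order_mult assms(1)) (auto simp: smooth_def)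
  qed (use Suc.prems assms(3) in \<open>auto simp: partial_inverse\<close>)
  then show ?case using Suc.prems assms(3) by (auto intro: field_differentiable_inverse)
qed simp

lemma smooth_mult: "open U \<Longrightarrow> smooth U f \<Longrightarrow> smooth U g \<Longrightarrow> smooth U (\<lambda>z. f z * g z)"
  by (simp add: smooth_def smooth_order_mult)

lemma smooth_inverse:
  "open U \<Longrightarrow> smooth U f \<Longrightarrow> (\<And>z. z \<in> U \<Longrightarrow> f z \<noteq> 0) \<Longrightarrow> smooth U (\<lambda>z. inverse (f z))"
  by (simp add: smooth_def smooth_order_inverse)

lemma smooth_partial: "smooth U f \<Longrightarrow> smooth U (partial k f)"
  unfolding smooth_def by (metis smooth_order.simps(2))

lemma smooth_differentiable:
  "smooth U f \<Longrightarrow> z \<in> U \<Longrightarrow> (\<lambda>t. f (z + axis k t)) field_differentiable at 0"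
  unfolding smooth_def by (metis smooth_order.simps(2))

lemma foldr_partial_add:
  assumes "open U" "smooth U f" "smooth U g" "z \<in> U"
  shows "foldr partial ks (\<lambda>u. f u + g u) z = foldr partial ks f z + foldr partial ks g z"
  using assms(2,3)
proof (induction ks arbitrary: f g rule: rev_induct)
  case (snoc k ks)
  have "foldr partial (ks @ [k]) (\<lambda>u. f u + g u) z = foldr partial ks (\<lambda>u. partial k f u + partial k g u) z"
    using snoc.prems unfolding foldr_append foldr.simps comp_apply id_apply
    by (intro foldr_partial_cong[OF assms(1) _ assms(4)] partial_add) (auto intro: smooth_differentiable)
  also have "\<dots> = foldr partial (ks @ [k]) f z + foldr partial (ks @ [k]) g z"
    using snoc by (simp add: smooth_partial)
  finally show ?case .
qed simp

section \<open>Taylor series as ring homomorphisms\<close>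

text \<open>
  Let \<open>D = \<Sum>\<^sub>k s\<^sub>k \<partial>\<^sub>k\<close>. The Taylor term of order \<open>m\<close> is \<open>(D\<^sup>m f)(b)\<close>, before division by \<open>m!\<close>, written as
  a sum over words. The target ring is an arbitrary commutative ring over \<open>\<complex>\<close>; below it is the even part
  of a Grassmann algebra and the \<open>s\<^sub>k\<close> are the souls of the even coordinates.
\<close>

definition taylor_term ::
    "(complex \<Rightarrow> 'r::comm_ring_1) \<Rightarrow> ('p::finite \<Rightarrow> 'r) \<Rightarrow> complex ^ 'p \<Rightarrow> nat \<Rightarrow>
     (complex ^ 'p \<Rightarrow> complex) \<Rightarrow> 'r" where
  "taylor_term \<iota> s b m f =
    (\<Sum>ks | length ks = m. \<iota> (foldr partial ks f b) * prod_list (map s ks))"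

lemma taylor_term_0: "taylor_term \<iota> s b 0 f = \<iota> (f b)"
  by (simp add: taylor_term_def)

text \<open>
  Splitting off the last letter of a word, which is the derivative that is applied first, makes the term of
  order \<open>m + 1\<close> of \<open>f\<close> a combination of terms of order \<open>m\<close> of first derivatives of \<open>f\<close>. The Leibniz rule
  is then needed only for a single derivative at a time.
\<close>

lemma taylor_term_Suc:
  "taylor_term \<iota> s b (Suc m) f = (\<Sum>k\<in>UNIV. taylor_term \<iota> s b m (partial k f) * s k)"
proof -
  have "taylor_term \<iota> s b (Suc m) f =
      (\<Sum>(k, ks)\<in>UNIV \<times> {ks. length ks = m}. \<iota> (foldr partial ks (partial k f) b) * prod_list (map s ks) * s k)"
    unfolding taylor_term_def
  proof (rule sum.reindex_bij_witness[where i = "\<lambda>(k, ks). ks @ [k]" and j = "\<lambda>ks. (last ks, butlast ks)"], goal_cases)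
    case (5 ks)
    then show ?case by (cases ks rule: rev_cases) (auto simp: mult_ac)
  qed (auto intro: append_butlast_last_id)
  also have "\<dots> = (\<Sum>k\<in>UNIV. taylor_term \<iota> s b m (partial k f) * s k)"
    by (simp add: sum.cartesian_product[symmetric] taylor_term_def sum_distrib_right)
  finally show ?thesis .
qed

lemma taylor_term_cong:
  assumes "open U" "\<And>z. z \<in> U \<Longrightarrow> f z = g z" "b \<in> U"
  shows "taylor_term \<iota> s b m f = taylor_term \<iota> s b m g"
  unfolding taylor_term_def
  by (rule sum.cong) (use foldr_partial_cong[OF assms] in auto)

text \<open>
  The combinatorial core of the iterated Leibniz rule: if \<open>D\<close> acts on a product by the Leibniz rule, so
  that \<open>A\<close> and \<open>B\<close> are the sequences of derivatives of the two factors, then one further application of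
  \<open>D\<close> turns the \<open>m\<close>-th row of Pascal's triangle into the next one.
\<close>

lemma pascal_convolution:
  fixes A B :: "nat \<Rightarrow> 'r::comm_ring_1"
  shows "(\<Sum>a\<le>m. of_nat (m choose a) * (A (Suc a) * B (m - a) + A a * B (Suc (m - a)))) =
    (\<Sum>a\<le>Suc m. of_nat (Suc m choose a) * (A a * B (Suc m - a)))"
proof -
  have "(\<Sum>a\<le>Suc m. of_nat (Suc m choose a) * (A a * B (Suc m - a))) =
      A 0 * B (Suc m) + (\<Sum>a\<le>m. of_nat (m choose Suc a) * (A (Suc a) * B (m - a))) +
      (\<Sum>a\<le>m. of_nat (m choose a) * (A (Suc a) * B (m - a)))"
    by (subst sum.atMost_Suc_shift) (simp add: algebra_simps sum.distrib)
  also have "A 0 * B (Suc m) + (\<Sum>a\<le>m. of_nat (m choose Suc a) * (A (Suc a) * B (m - a))) =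
      (\<Sum>a\<le>Suc m. of_nat (m choose a) * (A a * B (Suc m - a)))"
    by (subst sum.atMost_Suc_shift) simp
  also have "\<dots> = (\<Sum>a\<le>m. of_nat (m choose a) * (A a * B (Suc (m - a))))"
    by (simp add: Suc_diff_le binomial_eq_0)
  finally show ?thesis by (simp add: algebra_simps sum.distrib)
qed

definition taylor_sum ::
    "(complex \<Rightarrow> 'r::comm_ring_1) \<Rightarrow> nat \<Rightarrow> ('p::finite \<Rightarrow> 'r) \<Rightarrow> complex ^ 'p \<Rightarrow>
     (complex ^ 'p \<Rightarrow> complex) \<Rightarrow> 'r" where
  "taylor_sum \<iota> N s b f = (\<Sum>m\<le>N. \<iota> (1 / fact m) * taylor_term \<iota> s b m f)"

context
  fixes \<iota> :: "complex \<Rightarrow> 'r::comm_ring_1"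
  assumes \<iota>_add: "\<And>x y. \<iota> (x + y) = \<iota> x + \<iota> y"
    and \<iota>_mult: "\<And>x y. \<iota> (x * y) = \<iota> x * \<iota> y"
    and \<iota>_1: "\<iota> 1 = 1"
begin

lemma \<iota>_of_nat: "\<iota> (of_nat n) = of_nat n"
proof (induction n)
  case 0
  have "\<iota> 0 + \<iota> 0 = \<iota> 0" using \<iota>_add[of 0 0] by simp
  then show ?case by simp
qed (simp add: \<iota>_add \<iota>_1)

lemma taylor_term_add:
  assumes "open U" "smooth U f" "smooth U g" "b \<in> U"
  shows "taylor_term \<iota> s b m (\<lambda>u. f u + g u) = taylor_term \<iota> s b m f + taylor_term \<iota> s b m g"
  unfolding taylor_term_def
  by (simp add: foldr_partial_add[OF assms] \<iota>_add ring_distribs sum.distrib)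

text \<open>
  The iterated Leibniz rule for \<open>D\<close>. The induction varies \<open>f\<close> and \<open>g\<close>, since its hypothesis is applied to
  the products of a first derivative of one factor with the other factor.
\<close>

lemma taylor_term_mult:
  assumes "open U" "smooth U f" "smooth U g" "b \<in> U"
  shows "taylor_term \<iota> s b m (\<lambda>u. f u * g u) =
    (\<Sum>a\<le>m. of_nat (m choose a) * (taylor_term \<iota> s b a f * taylor_term \<iota> s b (m - a) g))"
  using assms(2,3)
proof (induction m arbitrary: f g)
  case 0
  then show ?case by (simp add: taylor_term_0 \<iota>_mult)
next
  case (Suc m)
  note smooth = Suc.prems smooth_partial[OF Suc.prems(1)] smooth_partial[OF Suc.prems(2)]
  let ?T = "taylor_term \<iota> s b"
  have "?T m (partial k (\<lambda>u. f u * g u)) =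
      (\<Sum>a\<le>m. of_nat (m choose a) * (?T a (partial k f) * ?T (m - a) g + ?T a f * ?T (m - a) (partial k g)))" for k
  proof -
    have "?T m (partial k (\<lambda>u. f u * g u)) = ?T m (\<lambda>u. partial k f u * g u + f u * partial k g u)"
      using smooth by (intro taylor_term_cong[OF assms(1) _ assms(4)] partial_mult)
        (auto intro: smooth_differentiable)
    also have "\<dots> = ?T m (\<lambda>u. partial k f u * g u) + ?T m (\<lambda>u. f u * partial k g u)"
      using smooth by (intro taylor_term_add[OF assms(1) _ _ assms(4)] smooth_mult assms(1))
    finally show ?thesis
      using Suc.IH[OF smooth(3,2), of k] Suc.IH[OF smooth(1,4), of k]
      by (simp only: ring_distribs sum.distrib)
  qed
  then have "?T (Suc m) (\<lambda>u. f u * g u) = (\<Sum>k\<in>UNIV. \<Sum>a\<le>m. of_nat (m choose a) *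
      (?T a (partial k f) * s k * ?T (m - a) g + ?T a f * (?T (m - a) (partial k g) * s k)))"
    by (simp add: taylor_term_Suc sum_distrib_left sum_distrib_right algebra_simps)
  also have "\<dots> = (\<Sum>a\<le>m. of_nat (m choose a) * (?T (Suc a) f * ?T (m - a) g + ?T a f * ?T (Suc (m - a)) g))"
    by (subst sum.swap)
      (simp add: taylor_term_Suc sum_distrib_left sum_distrib_right sum.distrib ring_distribs mult_ac)
  also note pascal_convolution
  finally show ?case .
qed

lemma taylor_term_mult_eq_0:
  assumes nilpotent: "\<And>ks. length ks > N \<Longrightarrow> prod_list (map s ks) = 0" and "a + a' > N"
  shows "taylor_term \<iota> s b a f * taylor_term \<iota> s b a' g = 0"
  unfolding taylor_term_def sum_product
proof (intro sum.neutral ballI)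
  fix ks ls :: "'a list" assume "ks \<in> {ks. length ks = a}" "ls \<in> {ls. length ls = a'}"
  then have "prod_list (map s ks) * prod_list (map s ls) = 0"
    using nilpotent[of "ks @ ls"] assms(2) by simp
  then show "\<iota> (foldr partial ks f b) * prod_list (map s ks) *
      (\<iota> (foldr partial ls g b) * prod_list (map s ls)) = 0"
    by (metis (no_types, lifting) mult.assoc mult.left_commute mult_zero_right)
qed

text \<open>
  The operator \<open>exp D\<close> is multiplicative because \<open>D\<close> is a derivation. Truncation at order \<open>N\<close> does no harm:
  the terms of the product of two truncated series that are missing on the left have total order above
  \<open>N\<close>, and vanish by nilpotency.
\<close>

lemma taylor_sum_mult:
  assumes "open U" "smooth U f" "smooth U g" "b \<in> U"
    and nilpotent: "\<And>ks. length ks > N \<Longrightarrow> prod_list (map s ks) = 0"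
  shows "taylor_sum \<iota> N s b (\<lambda>u. f u * g u) = taylor_sum \<iota> N s b f * taylor_sum \<iota> N s b g"
proof -
  let ?T = "taylor_term \<iota> s b"
  let ?c = "\<lambda>m. \<iota> (1 / fact m)"
  have fact: "?c m * of_nat (m choose a) = ?c a * ?c (m - a)" if "a \<le> m" for m a
  proof -
    have "1 / fact m * complex_of_nat (m choose a) = 1 / fact a * (1 / fact (m - a))"
      using that by (simp add: binomial_fact)
    then show ?thesis by (metis \<iota>_mult \<iota>_of_nat)
  qed
  have "taylor_sum \<iota> N s b (\<lambda>u. f u * g u) =
      (\<Sum>m\<le>N. \<Sum>a\<le>m. ?c m * of_nat (m choose a) * (?T a f * ?T (m - a) g))"
    by (simp add: taylor_sum_def taylor_term_mult[OF assms(1-4)] sum_distrib_left mult_ac)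
  also have "\<dots> = (\<Sum>m\<le>N. \<Sum>a\<le>m. (?c a * ?T a f) * (?c (m - a) * ?T (m - a) g))"
  proof (intro sum.cong refl)
    fix m a :: nat assume "a \<in> {..m}"
    then have "?c m * of_nat (m choose a) = ?c a * ?c (m - a)" by (simp add: fact)
    then show "?c m * of_nat (m choose a) * (?T a f * ?T (m - a) g) =
        (?c a * ?T a f) * (?c (m - a) * ?T (m - a) g)"
      by (simp only: mult_ac)
  qed
  also have "\<dots> = (\<Sum>(a, a') | a + a' \<le> N. (?c a * ?T a f) * (?c a' * ?T a' g))"
    by (rule sum.triangle_reindex_eq[symmetric])
  also have "\<dots> = (\<Sum>(a, a')\<in>{..N} \<times> {..N}. (?c a * ?T a f) * (?c a' * ?T a' g))"
  proof (rule sum.mono_neutral_left)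
    show "\<forall>p\<in>{..N} \<times> {..N} - {(a, a'). a + a' \<le> N}.
        (case p of (a, a') \<Rightarrow> (?c a * ?T a f) * (?c a' * ?T a' g)) = 0"
    proof
      fix p assume "p \<in> {..N} \<times> {..N} - {(a, a'). a + a' \<le> N}"
      then obtain a a' where p: "p = (a, a')" and "a + a' > N" by (cases p) auto
      then have "?T a f * ?T a' g = 0"
        by (intro taylor_term_mult_eq_0[where N = N] nilpotent) auto
      then have "(?c a * ?T a f) * (?c a' * ?T a' g) = 0"
        by (metis (no_types, lifting) mult.assoc mult.left_commute mult_zero_right)
      then show "(case p of (a, a') \<Rightarrow> (?c a * ?T a f) * (?c a' * ?T a' g)) = 0" by (simp add: p)
    qed
  qed auto
  also have "\<dots> = taylor_sum \<iota> N s b f * taylor_sum \<iota> N s b g"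
    by (simp add: taylor_sum_def sum_product sum.cartesian_product)
  finally show ?thesis .
qed

end

section \<open>Evaluation of functions at even Grassmann elements\<close>

lift_definition even_const :: "complex \<Rightarrow> 'q::finite even_grassmann" is gconst
  by simp

lemma even_const_add: "even_const (x + y) = even_const x + even_const y"
  by transfer (rule gconst_add)

lemma even_const_mult: "even_const (x * y) = even_const x * even_const y"
  by transfer (rule gconst_mult)

lemma even_const_1: "even_const 1 = 1"
  by transfer simp

lemma of_even_sum: "of_even (sum f A) = (\<Sum>a\<in>A. of_even (f a))"
  by (induction A rule: infinite_finite_induct)
    (auto simp: zero_even_grassmann.rep_eq plus_even_grassmann.rep_eq)

lemma of_even_prod_list: "of_even (prod_list xs) = prod_list (map of_even xs)"
  by (induction xs) (auto simp: one_even_grassmann.rep_eq times_even_grassmann.rep_eq)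

lemma even_soul: "even_element x \<Longrightarrow> even_element (soul x)"
  by (simp add: soul_def even_element_diff)

text \<open>The point at which the Taylor series of a superfunction of \<open>w\<close> is developed.\<close>

definition body_point :: "'q::finite grassmann ^ 'p::finite \<Rightarrow> complex ^ 'p" where
  "body_point w = (\<chi> k. body (w $ k))"

lemma grassmann_extension_cong:
  assumes "open U" "\<And>z. z \<in> U \<Longrightarrow> f z = g z" "body_point w \<in> U"
  shows "grassmann_extension f w = grassmann_extension g w"
  unfolding grassmann_extension_def body_point_def[symmetric]
  by (rule sum.cong) (use foldr_partial_cong[OF assms] in auto)

lemma lists_length_le_eq: "{ks. length ks \<le> N} = (\<Union>m\<le>N. {ks. length ks = m})"
  by auto

lemma grassmann_extension_eq_taylor_sum:
  fixes w :: "'q::finite grassmann ^ 'p::finite"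
  assumes "\<And>k. even_element (w $ k)"
  shows "grassmann_extension f w =
    of_even (taylor_sum even_const CARD('q) (\<lambda>k. Even_grassmann (soul (w $ k))) (body_point w) f)"
proof -
  have [simp]: "of_even (Even_grassmann (soul (w $ k))) = soul (w $ k)" for k
    using even_soul[OF assms] by (simp add: Even_grassmann_inverse)
  have fin: "finite {ks :: 'p list. length ks = m}" for m
    using finite_lists_length_eq[of "UNIV :: 'p set" m] by simp
  show ?thesis
    unfolding grassmann_extension_def lists_length_le_eq
    by (subst sum.UNION_disjoint)
      (auto simp: fin taylor_sum_def taylor_term_def of_even_sum of_even_prod_list
        times_even_grassmann.rep_eq even_const.rep_eq sum_distrib_left comp_def
        gconst_mult[symmetric] mult.assoc[symmetric] body_point_def intro!: sum.cong)
qed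

text \<open>
  Together with additivity and the values on constants and coordinates, multiplicativity says that
  \<open>f \<mapsto> f(w)\<close> is the homomorphism that substitutes \<open>w\<close> for the coordinates. In particular the value of a
  reciprocal is the reciprocal of the value, so that pullbacks of rational functions need no explicit
  derivatives.
\<close>

lemma grassmann_extension_mult:
  fixes w :: "'q::finite grassmann ^ 'p::finite"
  assumes even: "\<And>k. even_element (w $ k)"
    and "open U" "smooth U f" "smooth U g" "body_point w \<in> U"
  shows "grassmann_extension (\<lambda>u. f u * g u) w = grassmann_extension f w * grassmann_extension g w"
proof -
  have "prod_list (map (\<lambda>k. Even_grassmann (soul (w $ k))) ks) = 0" if "length ks > CARD('q)" for ks
  proof -
    have "of_even (prod_list (map (\<lambda>k. Even_grassmann (soul (w $ k))) ks)) = 0"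
      using prod_list_souls_eq_0[OF that, of "\<lambda>k. w $ k"] even_soul[OF even]
      by (simp add: of_even_prod_list comp_def Even_grassmann_inverse)
    then show ?thesis by (metis of_even_inject zero_even_grassmann.rep_eq)
  qed
  then show ?thesis
    by (simp add: grassmann_extension_eq_taylor_sum[OF even] taylor_sum_mult[OF even_const_add
      even_const_mult even_const_1 assms(2-5)] times_even_grassmann.rep_eq)
qed

lemma grassmann_extension_add:
  fixes w :: "'q::finite grassmann ^ 'p::finite"
  assumes "open U" "smooth U f" "smooth U g" "body_point w \<in> U"
  shows "grassmann_extension (\<lambda>u. f u + g u) w = grassmann_extension f w + grassmann_extension g w"
  unfolding grassmann_extension_def body_point_def[symmetric]
  by (simp add: foldr_partial_add[OF assms] gconst_add ring_distribs sum.distrib add_divide_distrib)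

lemma even_grassmann_extension:
  assumes "\<And>k. even_element (w $ k)"
  shows "even_element (grassmann_extension f w)"
  using of_even by (auto simp: grassmann_extension_eq_taylor_sum[OF assms])

lemma foldr_partial_const: "foldr partial ks (\<lambda>_. c) = (\<lambda>_. if ks = [] then c else 0)"
  by (induction ks) auto

lemma grassmann_extension_const [simp]:
  fixes w :: "'q::finite grassmann ^ 'p::finite"
  shows "grassmann_extension (\<lambda>_. c) w = gconst c"
proof -
  have "grassmann_extension (\<lambda>_. c) w = (\<Sum>ks :: 'p list | length ks \<le> CARD('q). if ks = [] then gconst c else 0)"
    unfolding grassmann_extension_def foldr_partial_const by (rule sum.cong) simp_all
  also have "\<dots> = gconst c"
    using finite_lists_length_le[of "UNIV :: 'p set" "CARD('q)"] by simp
  finally show ?thesis .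
qed

lemma foldr_partial_component:
  "foldr partial ks (\<lambda>z. z $ l) z = (if ks = [] then z $ l else if ks = [l] then 1 else 0)"
proof (cases ks rule: rev_cases)
  case (snoc ks' k)
  then show ?thesis by (simp add: foldr_partial_const)
qed simp

text \<open>
  Only the empty word and the word \<open>l\<close> contribute to the Taylor series of the \<open>l\<close>-th coordinate; they give
  the body and the soul of \<open>w\<^sub>l\<close>.
\<close>

lemma grassmann_extension_component:
  fixes w :: "'q::finite grassmann ^ 'p::finite"
  shows "grassmann_extension (\<lambda>z. z $ l) w = w $ l"
proof -
  have fin: "finite {ks :: 'p list. length ks \<le> CARD('q)}"
    using finite_lists_length_le[of "UNIV :: 'p set" "CARD('q)"] by simp
  have "grassmann_extension (\<lambda>z. z $ l) w = (\<Sum>ks\<in>{[], [l]}. 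
       gconst (foldr partial ks (\<lambda>z. z $ l) (\<chi> k. body (w $ k)) / fact (length ks)) *
       prod_list (map (\<lambda>k. soul (w $ k)) ks))"
    unfolding grassmann_extension_def
    by (rule sum.mono_neutral_right) (auto simp: fin foldr_partial_component Suc_leI)
  also have "\<dots> = w $ l"
    by (simp add: foldr_partial_component soul_def)
  finally show ?thesis .
qed

section \<open>Pullback of superfunctions of low degree\<close>

text \<open>
  Replacing \<open>\<theta>\<^sub>a\<close> by \<open>\<eta>\<^sub>a\<close> in an element with constant coefficients, the part of a pullback that does not
  concern the even coordinates.
\<close>

definition substitute_odd :: "'q::finite grassmann ^ 'q \<Rightarrow> 'q grassmann \<Rightarrow> 'q grassmann" where
  "substitute_odd \<eta> x =
    (\<Sum>S\<in>UNIV. gconst (gcoeff x S) * prod_list (map (\<lambda>a. \<eta> $ a) (increasing_list S)))"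

lemma substitute_odd_single:
  assumes "\<And>S. gcoeff x S = (if S = R then 1 else 0)"
  shows "substitute_odd \<eta> x = prod_list (map (\<lambda>a. \<eta> $ a) (increasing_list R))"
proof -
  have "substitute_odd \<eta> x =
      (\<Sum>S\<in>UNIV. if S = R then prod_list (map (\<lambda>a. \<eta> $ a) (increasing_list S)) else 0)"
    unfolding substitute_odd_def by (rule sum.cong) (auto simp: assms)
  then show ?thesis by simp
qed

lemma substitute_odd_0 [simp]: "substitute_odd \<eta> 0 = 0"
  by (simp add: substitute_odd_def zero_grassmann.rep_eq)

lemma substitute_odd_1 [simp]: "substitute_odd \<eta> 1 = 1"
  by (subst substitute_odd_single[where R = "{}"])
    (auto simp: one_grassmann.rep_eq increasing_list_def)

lemma substitute_odd_theta [simp]: "substitute_odd \<eta> (theta a) = \<eta> $ a"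
  by (subst substitute_odd_single[where R = "{a}"])
    (auto simp: theta.rep_eq increasing_list_def)

lemma substitute_odd_minus: "substitute_odd \<eta> (- x) = - substitute_odd \<eta> x"
  by (simp add: substitute_odd_def uminus_grassmann.rep_eq gconst_minus sum_negf)

lemma gcoeff_theta_mult_increasing:
  fixes a b :: "'q::finite"
  assumes "to_nat a < to_nat b"
  shows "gcoeff (theta a * theta b) S = (if S = {a, b} then 1 else 0)"
proof -
  have "inversions {a} {b} = 0"
    unfolding inversions_def using assms by (auto simp: card_eq_0_iff)
  moreover have "a \<noteq> b" using assms by auto
  ultimately have "gcoeff (theta a * theta b) S =
      (\<Sum>T\<in>Pow S. if T = {a} then (if S = {a, b} then 1 else 0) else 0)"
    unfolding times_grassmann.rep_eq theta.rep_eq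
    by (intro sum.cong) (auto simp: inversion_sign_def)
  then show ?thesis by auto
qed

text \<open>
  Substitution respects products of two generators because the \<open>\<eta>\<^sub>a\<close> anticommute like the \<open>\<theta>\<^sub>a\<close>: for
  generators in increasing order this is the definition, the other order costs a sign on both sides, and
  both sides vanish for equal generators.
\<close>

lemma substitute_odd_theta_mult:
  fixes a b :: "'q::finite"
  assumes "\<And>a. odd_element (\<eta> $ a)"
  shows "substitute_odd \<eta> (theta a * theta b) = \<eta> $ a * \<eta> $ b"
proof -
  have increasing: "substitute_odd \<eta> (theta a * theta b) = \<eta> $ a * \<eta> $ b" if "to_nat a < to_nat b" for a b
  proof -
    have "sorted_list_of_set {to_nat a, to_nat b} = [to_nat a, to_nat b]"
      using that by (auto simp: insert_Diff_if)
    then have "increasing_list {a, b} = [a, b]" by (simp add: increasing_list_def)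
    then show ?thesis
      using gcoeff_theta_mult_increasing[OF that] by (subst substitute_odd_single) auto
  qed
  consider "to_nat a < to_nat b" | "to_nat b < to_nat a" | "a = b"
    by (metis linorder_neqE_nat inj_to_nat injD)
  then show ?thesis
  proof cases
    case 2
    have "substitute_odd \<eta> (theta a * theta b) = - (\<eta> $ b * \<eta> $ a)"
      by (simp add: odd_anticommute[of "theta a" "theta b"] substitute_odd_minus increasing[OF 2])
    then show ?thesis using odd_anticommute[OF assms assms] by metis
  qed (simp_all add: increasing odd_square assms)
qed

text \<open>
  All transition functions of the \<open>\<Pi>\<close>-projective space are sums of two terms, each a function of the
  even coordinates times a constant Grassmann element.
\<close>

lemma pullback_two_terms:
  fixes w :: "complex ^ 'p::finite \<Rightarrow> 'q::finite grassmann ^ 'p"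
  assumes "\<And>k. even_element (w z $ k)" "open U" "body_point (w z) \<in> U"
    and "smooth U f" "smooth U g"
    and "\<And>u. u \<in> U \<Longrightarrow> F u = gconst (f u) * x + gconst (g u) * y"
  shows "pullback w \<eta> F z =
    grassmann_extension f (w z) * substitute_odd (\<eta> z) x +
    grassmann_extension g (w z) * substitute_odd (\<eta> z) y"
proof -
  let ?E = "\<lambda>f. grassmann_extension f (w z)"
  have "?E (\<lambda>u. gcoeff (F u) S) = ?E f * gconst (gcoeff x S) + ?E g * gconst (gcoeff y S)" for S
  proof -
    have "?E (\<lambda>u. gcoeff (F u) S) = ?E (\<lambda>u. f u * gcoeff x S + g u * gcoeff y S)"
      by (rule grassmann_extension_cong[OF assms(2)])
        (use assms in \<open>auto simp: plus_grassmann.rep_eq\<close>)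
    also have "\<dots> = ?E (\<lambda>u. f u * gcoeff x S) + ?E (\<lambda>u. g u * gcoeff y S)"
      by (intro grassmann_extension_add[where U = U] assms smooth_mult smooth_const)
    also have "\<dots> = ?E f * ?E (\<lambda>u. gcoeff x S) + ?E g * ?E (\<lambda>u. gcoeff y S)"
      using grassmann_extension_mult[OF assms(1,2) _ smooth_const assms(3)] assms(4,5) by simp
    finally show ?thesis by simp
  qed
  then show ?thesis
    by (simp add: pullback_def substitute_odd_def ring_distribs sum.distrib sum_distrib_left mult.assoc)
qed

section \<open>Pi-symmetric two by two blocks\<close>

text \<open>
  The \<open>\<Pi>\<close>-symmetric matrices \<open>x + I t\<close>, where \<open>I\<close> is the constant matrix with \<open>I\<^sup>2 = -1\<close> that is
  obtained from \<open>x = 0\<close>, \<open>t = 1\<close>. They multiply like Gaussian numbers over a possibly noncommutative ring,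
  hence form a ring in which the gluing rule of the \<open>\<Pi>\<close>-projective space can be manipulated without
  writing out entries.
\<close>

definition Pi_pair :: "'a::ring_1 \<Rightarrow> 'a \<Rightarrow> 'a ^ (unit + unit) ^ (unit + unit)" where
  "Pi_pair x t = (\<chi> r c. case (r, c) of
      (Inl _, Inl _) \<Rightarrow> x | (Inl _, Inr _) \<Rightarrow> t | (Inr _, Inl _) \<Rightarrow> - t | (Inr _, Inr _) \<Rightarrow> x)"

lemma Pi_pair_nth [simp]:
  "Pi_pair x t $ Inl u $ Inl v = x" "Pi_pair x t $ Inl u $ Inr v = t"
  "Pi_pair x t $ Inr u $ Inl v = - t" "Pi_pair x t $ Inr u $ Inr v = x"
  by (simp_all add: Pi_pair_def)

lemma sum_UNIV_sum_type: "(\<Sum>c\<in>(UNIV :: ('a::finite + 'b::finite) set). f c) = (\<Sum>a\<in>UNIV. f (Inl a)) + (\<Sum>b\<in>UNIV. f (Inr b))"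
  by (simp add: sum.Plus UNIV_Plus_UNIV[symmetric] del: UNIV_Plus_UNIV)

lemma matrix_unit_sum_eqI:
  fixes A B :: "'a ^ (unit + unit) ^ (unit + unit)"
  assumes "A $ Inl () $ Inl () = B $ Inl () $ Inl ()" "A $ Inl () $ Inr () = B $ Inl () $ Inr ()"
    "A $ Inr () $ Inl () = B $ Inr () $ Inl ()" "A $ Inr () $ Inr () = B $ Inr () $ Inr ()"
  shows "A = B"
proof -
  have "A $ r $ c = B $ r $ c" for r c
    using assms by (cases r; cases c) auto
  then show ?thesis by (simp add: vec_eq_iff)
qed

lemma Pi_pair_mult: "Pi_pair x t ** Pi_pair y s = Pi_pair (x * y - t * s) (x * s + t * y)"
  by (rule matrix_unit_sum_eqI) (simp_all add: matrix_matrix_mult_def sum_UNIV_sum_type UNIV_unit algebra_simps)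

lemma Pi_pair_1_0: "Pi_pair 1 0 = mat 1"
  by (rule matrix_unit_sum_eqI) (simp_all add: mat_def)

lemma matrix_inv_eqI:
  fixes A :: "'a::semiring_1 ^ 'n ^ 'm" and B :: "'a ^ 'm ^ 'n"
  assumes "A ** B = mat 1" "B ** A = mat 1"
  shows "matrix_inv A = B"
proof -
  have "A ** matrix_inv A = mat 1 \<and> matrix_inv A ** A = mat 1"
    unfolding matrix_inv_def by (rule someI[of _ B]) (use assms in simp)
  then show ?thesis by (metis assms(2) matrix_mul_assoc matrix_mul_lid matrix_mul_rid)
qed

text \<open>
  The inverse of \<open>x + I t\<close> is \<open>x\<^sup>-\<^sup>1 - I x\<^sup>-\<^sup>2 t\<close>: the geometric series stops after the linear term since
  \<open>t\<^sup>2 = 0\<close>.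
\<close>

lemma Pi_pair_inverse:
  fixes x v t :: "'q::finite grassmann"
  assumes "v * x = 1" "even_element x" "even_element v" "odd_element t"
  shows "Pi_pair v (- (v * v * t)) ** Pi_pair x t = mat 1" "Pi_pair x t ** Pi_pair v (- (v * v * t)) = mat 1"
proof -
  have xv: "x * v = 1" using even_central[OF assms(2), of v] assms(1) by simp
  have tx: "t * x = x * t" and tv: "t * v = v * t"
    using even_central[OF assms(2), of t] even_central[OF assms(3), of t] by auto
  have "v * v * t * t = 0" using odd_square[OF assms(4)] by (simp add: mult.assoc)
  moreover have "v * v * t * x = v * t"
    by (metis assms(1) tx mult.assoc mult_1_left mult_1_right xv)
  ultimately show "Pi_pair v (- (v * v * t)) ** Pi_pair x t = mat 1"
    by (simp add: Pi_pair_mult assms(1) Pi_pair_1_0[symmetric])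
  have "t * (v * v * t) = 0"
    by (metis tv mult.assoc mult_zero_right odd_square[OF assms(4)])
  moreover have "x * (v * v * t) = t * v"
    by (metis mult.assoc mult_1_left tv xv)
  ultimately show "Pi_pair x t ** Pi_pair v (- (v * v * t)) = mat 1"
    by (simp add: Pi_pair_mult xv Pi_pair_1_0[symmetric])
qed

lemma matrix_inv_Pi_pair:
  fixes x v t :: "'q::finite grassmann"
  assumes "v * x = 1" "even_element x" "even_element v" "odd_element t"
  shows "matrix_inv (Pi_pair x t) = Pi_pair v (- (v * v * t))"
  by (rule matrix_inv_eqI[OF Pi_pair_inverse(2,1)[OF assms]])

section \<open>Transition functions of the Pi-projective space\<close>

text \<open>
  The reduced coordinate \<open>z\<^bsub>\<ell>i\<^esub> = X\<^sub>\<ell> / X\<^sub>i\<close>, with \<open>z\<^bsub>ii\<^esub> = 1\<close> included: the transition functions and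
  their composites are uniform in \<open>\<ell>\<close> only if the normalised coordinate is kept.
\<close>

definition chart_coord :: "'n::finite option \<Rightarrow> complex ^ 'n \<Rightarrow> 'n option \<Rightarrow> complex" where
  "chart_coord i z l = (if l = i then 1 else z $ inv (chart_label i) l)"

lemma inv_chart_label [simp]: "inv (chart_label i) (chart_label i k) = k"
  by (rule inv_f_f[OF inj_chart_label])

lemma chart_label_neq [simp]: "chart_label i k \<noteq> i" "i \<noteq> chart_label i k"
  using range_chart_label[of i] by (metis DiffE rangeI singletonI)+

lemma chart_label_cases:
  assumes "l = i \<Longrightarrow> P" "\<And>k. l = chart_label i k \<Longrightarrow> P"
  shows P
  using assms range_chart_label[of i] by blast

lemma chart_coord_self [simp]: "chart_coord i z i = 1"
  by (simp add: chart_coord_def)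

lemma chart_coord_label [simp]: "chart_coord i z (chart_label i k) = z $ k"
  by (simp add: chart_coord_def)

lemma odd_coord_self [simp]: "odd_coord i i = 0"
  by (simp add: odd_coord_def)

lemma odd_coord_label [simp]: "odd_coord i (chart_label i k) = theta k"
  by (simp add: odd_coord_def)

lemma odd_odd_coord [simp]: "odd_element (odd_coord i l)"
  by (simp add: odd_coord_def)

lemma even_coord_eq: "even_coord i z l = gconst (chart_coord i z l)"
  by (simp add: even_coord_def chart_coord_def)

text \<open>
  The pair of columns, one even and one odd, that belongs to the homogeneous index \<open>l\<close>. Each of the
  matrices \<open>\<Z>\<^sub>i\<close> is a row of such blocks, and left multiplication acts on each block separately.
\<close>

definition Pi_block :: "'m::finite \<Rightarrow> 'a ^ ('m + 'm) ^ (unit + unit) \<Rightarrow> 'a ^ (unit + unit) ^ (unit + unit)" where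
  "Pi_block l = super_block id (\<lambda>c. case c of Inl _ \<Rightarrow> Inl l | Inr _ \<Rightarrow> Inr l)"

lemma Pi_block_mult: "Pi_block l (B ** M) = B ** Pi_block l M"
  by (simp add: Pi_block_def super_block_def matrix_matrix_mult_def vec_eq_iff)

lemma Pi_block_Pi_matrix:
  "Pi_block l (Pi_matrix i z) = Pi_pair (gconst (chart_coord i z l)) (odd_coord i l)"
  by (rule matrix_unit_sum_eqI)
    (simp_all add: Pi_block_def super_block_def Pi_matrix_def even_coord_eq)

text \<open>
  The entries of \<open>\<Z>\<^sub>j = \<B>\<^sub>i\<^sub>j\<^sup>-\<^sup>1 \<Z>\<^sub>i\<close> in closed form,
  \<open>z\<^bsub>\<ell>j\<^esub> = z\<^bsub>\<ell>i\<^esub> / z\<^bsub>ji\<^esub> + \<theta>\<^bsub>ji\<^esub> \<theta>\<^bsub>\<ell>i\<^esub> / z\<^bsub>ji\<^esub>\<^sup>2\<close> and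
  \<open>\<theta>\<^bsub>\<ell>j\<^esub> = \<theta>\<^bsub>\<ell>i\<^esub> / z\<^bsub>ji\<^esub> - z\<^bsub>\<ell>i\<^esub> \<theta>\<^bsub>ji\<^esub> / z\<^bsub>ji\<^esub>\<^sup>2\<close>. Coefficients are products of coordinates and
  reciprocals, the form in which they are differentiated and substituted.
\<close>

definition glued_even :: "'n::finite option \<Rightarrow> 'n option \<Rightarrow> complex ^ 'n \<Rightarrow> 'n option \<Rightarrow> 'n grassmann" where
  "glued_even i j z l = gconst (chart_coord i z l * inverse (chart_coord i z j)) +
    gconst (inverse (chart_coord i z j) * inverse (chart_coord i z j)) * (odd_coord i j * odd_coord i l)"

definition glued_odd :: "'n::finite option \<Rightarrow> 'n option \<Rightarrow> complex ^ 'n \<Rightarrow> 'n option \<Rightarrow> 'n grassmann" where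
  "glued_odd i j z l = gconst (inverse (chart_coord i z j)) * odd_coord i l +
    gconst (- 1 * (chart_coord i z l * (inverse (chart_coord i z j) * inverse (chart_coord i z j)))) * odd_coord i j"

lemma even_glued_even: "even_element (glued_even i j z l)"
  by (simp add: glued_even_def even_element_add even_element_mult odd_mult_odd)

lemma odd_glued_odd: "odd_element (glued_odd i j z l)"
  by (simp add: glued_odd_def odd_add even_mult_odd)

lemma glued_self:
  assumes "chart_coord i z j \<noteq> 0"
  shows "glued_even i j z j = 1" "glued_odd i j z j = 0"
  using assms by (simp_all add: glued_even_def glued_odd_def odd_square gconst_minus mult.assoc[symmetric])

lemma Pi_pair_glued:
  fixes z :: "complex ^ 'n::finite"
  assumes "chart_coord i z j \<noteq> 0"
  shows "Pi_pair (glued_even i j z l) (glued_odd i j z l) =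
    matrix_inv (Pi_pair (gconst (chart_coord i z j)) (odd_coord i j)) **
    Pi_pair (gconst (chart_coord i z l)) (odd_coord i l)"
proof -
  let ?v = "gconst (inverse (chart_coord i z j)) :: 'n grassmann"
  have "?v * gconst (chart_coord i z j) = 1"
    using assms by (simp flip: gconst_mult)
  then have "matrix_inv (Pi_pair (gconst (chart_coord i z j)) (odd_coord i j)) =
      Pi_pair ?v (- (?v * ?v * odd_coord i j))"
    by (rule matrix_inv_Pi_pair) auto
  moreover have "?v * gconst (chart_coord i z l) =
      gconst (chart_coord i z l * inverse (chart_coord i z j))"
    by (simp add: gconst_mult[symmetric] mult.commute)
  moreover have "?v * ?v * odd_coord i j * gconst (chart_coord i z l) = gconst (chart_coord i z l *
      (inverse (chart_coord i z j) * inverse (chart_coord i z j))) * odd_coord i j"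
    unfolding gconst_commute[of "?v * ?v * odd_coord i j"] by (simp add: gconst_mult mult.assoc)
  ultimately show ?thesis
    by (simp add: Pi_pair_mult glued_even_def glued_odd_def gconst_minus gconst_mult mult.assoc)
qed

lemma Pi_glued_matrix_nth:
  assumes "chart_coord i z j \<noteq> 0"
  shows "Pi_glued_matrix i j z $ Inl () $ Inl l = glued_even i j z l"
    and "Pi_glued_matrix i j z $ Inl () $ Inr l = glued_odd i j z l"
proof -
  have "Pi_block l (Pi_glued_matrix i j z) = Pi_pair (glued_even i j z l) (glued_odd i j z l)"
    unfolding Pi_glued_matrix_def Pi_block_mult Pi_block_Pi_matrix Pi_pair_glued[OF assms]
    by (simp add: Pi_submatrix_def Pi_block_def[symmetric] Pi_block_Pi_matrix)
  then have "Pi_block l (Pi_glued_matrix i j z) $ Inl () $ Inl () = glued_even i j z l"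
    "Pi_block l (Pi_glued_matrix i j z) $ Inl () $ Inr () = glued_odd i j z l"
    by simp_all
  then show "Pi_glued_matrix i j z $ Inl () $ Inl l = glued_even i j z l"
    "Pi_glued_matrix i j z $ Inl () $ Inr l = glued_odd i j z l"
    by (simp_all add: Pi_block_def super_block_def)
qed

section \<open>The cocycle condition\<close>

abbreviation "even_tr i j \<equiv> even_trans (Pi_projective_space TYPE('n::finite)) i j"
abbreviation "odd_tr i j \<equiv> odd_trans (Pi_projective_space TYPE('n::finite)) i j"

lemma even_tr_nth: 
  "chart_coord i z j \<noteq> 0 \<Longrightarrow> even_tr i j z $ k = glued_even i j z (chart_label j k)"
  by (simp add: Pi_projective_space_def Pi_glued_matrix_nth)

lemma odd_tr_nth: 
  "chart_coord i z j \<noteq> 0 \<Longrightarrow> odd_tr i j z $ k = glued_odd i j z (chart_label j k)"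
  by (simp add: Pi_projective_space_def Pi_glued_matrix_nth)

lemma smooth_chart_coord: "smooth U (\<lambda>z. chart_coord i z l)"
  unfolding chart_coord_def by (cases "l = i") (auto intro: smooth_const smooth_component)

lemma open_chart_coord_nonzero: "open {z :: complex ^ 'n::finite. chart_coord i z l \<noteq> 0}"
proof (cases "l = i")
  case False
  then have "{z. chart_coord i z l \<noteq> 0} = (\<lambda>z. z $ inv (chart_label i) l) -` (- {0})"
    by (auto simp: chart_coord_def)
  then show ?thesis by (simp add: open_vimage_vec_nth open_Compl)
qed simp

lemma grassmann_extension_chart_coord:
  fixes z :: "complex ^ 'n::finite"
  assumes "chart_coord i z j \<noteq> 0"
  shows "grassmann_extension (\<lambda>u. chart_coord j u l) (even_tr i j z) = glued_even i j z l"
proof (cases l j rule: chart_label_cases)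
  case 1
  then show ?thesis using glued_self[OF assms] by simp
next
  case (2 k)
  then show ?thesis using even_tr_nth[OF assms] by (simp add: grassmann_extension_component)
qed

lemma substitute_odd_coord:
  assumes "chart_coord i z j \<noteq> 0"
  shows "substitute_odd (odd_tr i j z) (odd_coord j l) = glued_odd i j z l"
  by (cases l j rule: chart_label_cases) (simp_all add: odd_tr_nth[OF assms] glued_self[OF assms])

lemma substitute_odd_coord_mult:
  assumes "chart_coord i z j \<noteq> 0"
  shows "substitute_odd (odd_tr i j z) (odd_coord j l * odd_coord j m) = glued_odd i j z l * glued_odd i j z m"
  by (cases l j rule: chart_label_cases; cases m j rule: chart_label_cases)
    (simp_all add: substitute_odd_theta_mult odd_tr_nth[OF assms] odd_glued_odd glued_self[OF assms])

lemma body_glued_even: "body (glued_even i j z l) = chart_coord i z l * inverse (chart_coord i z j)"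
  by (simp add: body_def glued_even_def plus_grassmann.rep_eq gconst.rep_eq times_grassmann.rep_eq
      odd_odd_coord[unfolded odd_element_def, rule_format])

lemma chart_coord_body_point:
  fixes z :: "complex ^ 'n::finite"
  assumes "chart_coord i z j \<noteq> 0"
  shows "chart_coord j (body_point (even_tr i j z)) l = chart_coord i z l * inverse (chart_coord i z j)"
  by (cases l j rule: chart_label_cases)
    (use assms in \<open>simp_all add: body_point_def even_tr_nth body_glued_even\<close>)

text \<open>
  The cocycle condition. As substitution is a homomorphism, the pullback of \<open>\<Z>\<^sub>l = \<B>\<^sub>j\<^sub>l\<^sup>-\<^sup>1 \<Z>\<^sub>j\<close> to the
  \<open>i\<close>-th chart is the same formula with the entries of \<open>\<Z>\<^sub>j = \<B>\<^sub>i\<^sub>j\<^sup>-\<^sup>1 \<Z>\<^sub>i\<close> inserted. The \<open>l\<close>-th block of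
  \<open>\<Z>\<^sub>j\<close> is \<open>\<B>\<^sub>i\<^sub>j\<^sup>-\<^sup>1 \<B>\<^sub>i\<^sub>l\<close>, so the result is
  \<open>(\<B>\<^sub>i\<^sub>j\<^sup>-\<^sup>1 \<B>\<^sub>i\<^sub>l)\<^sup>-\<^sup>1 \<B>\<^sub>i\<^sub>j\<^sup>-\<^sup>1 \<Z>\<^sub>i = \<B>\<^sub>i\<^sub>l\<^sup>-\<^sup>1 \<Z>\<^sub>i\<close>.
\<close>

lemma pullback_transition:
  fixes z :: "complex ^ 'n::finite"
  assumes ij: "chart_coord i z j \<noteq> 0" and il: "chart_coord i z l \<noteq> 0"
  shows "pullback (even_tr i j) (odd_tr i j) (\<lambda>u. even_tr j l u $ k) z = even_tr i l z $ k" (is ?even)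
    and "pullback (even_tr i j) (odd_tr i j) (\<lambda>u. odd_tr j l u $ k) z = odd_tr i l z $ k" (is ?odd)
proof -
  define m where "m = chart_label l k"
  define U where "U = {u :: complex ^ 'n. chart_coord j u l \<noteq> 0}"
  define E where "E = (\<lambda>f. grassmann_extension f (even_tr i j z))"
  let ?x = "\<lambda>u. chart_coord j u l" and ?y = "\<lambda>u. chart_coord j u m"
  let ?W = "glued_even i j z" and ?H = "glued_odd i j z"
  \<comment> \<open>The value of \<open>1 / z\<^bsub>lj\<^esub>\<close> at the glued coordinates. Its equation \<open>V * ?W l = 1\<close> is all that is used about reciprocals.\<close>
  define V where "V = E (\<lambda>u. inverse (?x u))"
  have even: "even_element (even_tr i j z $ k)" for k
    by (simp add: even_tr_nth[OF ij] even_glued_even)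
  have U: "open U" "body_point (even_tr i j z) \<in> U"
    using ij il open_chart_coord_nonzero by (auto simp: U_def chart_coord_body_point[OF ij])
  have smooth: "smooth U ?x" "smooth U ?y" "smooth U (\<lambda>u. inverse (?x u))"
    by (auto simp: U_def intro!: smooth_chart_coord smooth_inverse open_chart_coord_nonzero)
  note smooths = smooth smooth_mult U(1) smooth_const
  have E_mult: "E (\<lambda>u. f u * g u) = E f * E g" if "smooth U f" "smooth U g" for f g
    unfolding E_def by (rule grassmann_extension_mult[OF even U(1) that U(2)])
  have E_coord: "E (\<lambda>u. chart_coord j u a) = ?W a" for a
    unfolding E_def by (rule grassmann_extension_chart_coord[OF ij])
  have V: "V * ?W l = 1"
  proof -
    have "V * ?W l = E (\<lambda>u. inverse (?x u) * ?x u)"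
      using E_mult smooth by (simp add: V_def E_coord)
    also have "\<dots> = E (\<lambda>u. 1)"
      unfolding E_def by (rule grassmann_extension_cong[OF U(1) _ U(2)]) (simp add: U_def)
    finally show ?thesis by (simp add: E_def)
  qed
  have "even_element V" unfolding V_def E_def by (rule even_grassmann_extension[OF even])
  note inverse = matrix_inv_Pi_pair[OF V even_glued_even this odd_glued_odd]
    Pi_pair_inverse[OF V even_glued_even this odd_glued_odd]
  let ?P = "\<lambda>a. Pi_pair (gconst (chart_coord i z a)) (odd_coord i a) :: 'n grassmann ^ (unit + unit) ^ (unit + unit)"
  have P_inv: "?P a ** matrix_inv (?P a) = mat 1" "matrix_inv (?P a) ** ?P a = mat 1"
    if "chart_coord i z a \<noteq> 0" for a
  proof -
    have *: "gconst (inverse (chart_coord i z a)) * gconst (chart_coord i z a) = (1 :: 'n grassmann)"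
      using that by (simp flip: gconst_mult)
    show "?P a ** matrix_inv (?P a) = mat 1" "matrix_inv (?P a) ** ?P a = mat 1"
      using Pi_pair_inverse[OF *] matrix_inv_Pi_pair[OF *] by auto
  qed
  \<comment> \<open>\<open>(\<B>\<^sub>i\<^sub>j\<^sup>-\<^sup>1 \<B>\<^sub>i\<^sub>l)\<^sup>-\<^sup>1 = \<B>\<^sub>i\<^sub>l\<^sup>-\<^sup>1 \<B>\<^sub>i\<^sub>j\<close>, where \<open>?P a\<close> is \<open>\<B>\<^sub>i\<^sub>a\<close>\<close>
  have "matrix_inv (Pi_pair (?W l) (?H l)) = matrix_inv (?P l) ** ?P j"
  proof (rule matrix_inv_eqI)
    show "Pi_pair (?W l) (?H l) ** (matrix_inv (?P l) ** ?P j) = mat 1"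
      unfolding Pi_pair_glued[OF ij]
      by (metis P_inv[OF ij] P_inv[OF il] matrix_mul_assoc matrix_mul_lid)
    show "matrix_inv (?P l) ** ?P j ** Pi_pair (?W l) (?H l) = mat 1"
      unfolding Pi_pair_glued[OF ij]
      by (metis P_inv[OF ij] P_inv[OF il] matrix_mul_assoc matrix_mul_lid)
  qed
  then have "Pi_pair V (- (V * V * ?H l)) ** Pi_pair (?W m) (?H m) =
      matrix_inv (?P l) ** ?P j ** (matrix_inv (?P j) ** ?P m)"
    unfolding inverse(1) by (simp add: Pi_pair_glued[OF ij])
  also have "\<dots> = matrix_inv (?P l) ** ?P m"
    by (metis P_inv(1)[OF ij] matrix_mul_assoc matrix_mul_lid)
  also have "\<dots> = Pi_pair (glued_even i l z m) (glued_odd i l z m)"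
    by (rule Pi_pair_glued[OF il, symmetric])
  finally have "Pi_pair (V * ?W m + V * V * ?H l * ?H m) (V * ?H m - V * V * ?H l * ?W m) = \<dots>"
    by (simp add: Pi_pair_mult)
  \<comment> \<open>The top row of the product of the two blocks is what the pullbacks below evaluate to.\<close>
  then have glue: "V * ?W m + V * V * ?H l * ?H m = glued_even i l z m"
    "V * ?H m - V * V * ?H l * ?W m = glued_odd i l z m"
    by (metis Pi_pair_nth(1), metis Pi_pair_nth(2))
  have "pullback (even_tr i j) (odd_tr i j) (\<lambda>u. even_tr j l u $ k) z =
      E (\<lambda>u. ?y u * inverse (?x u)) * substitute_odd (odd_tr i j z) 1 +
      E (\<lambda>u. inverse (?x u) * inverse (?x u)) * substitute_odd (odd_tr i j z) (odd_coord j l * odd_coord j m)"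
    unfolding E_def
    by (rule pullback_two_terms[where U = U])
      (auto simp: even U intro!: smooths, auto simp: U_def even_tr_nth glued_even_def m_def)
  also have "\<dots> = ?W m * V + V * V * (?H l * ?H m)"
    using smooth by (simp add: substitute_odd_coord_mult[OF ij] E_mult E_coord V_def[symmetric])
  also have "\<dots> = V * ?W m + V * V * ?H l * ?H m"
    using even_central[OF \<open>even_element V\<close>, of "?W m"] by (simp add: mult.assoc)
  finally show ?even
    using glue(1) even_tr_nth[OF il] by (simp add: m_def)
  have "pullback (even_tr i j) (odd_tr i j) (\<lambda>u. odd_tr j l u $ k) z =
      E (\<lambda>u. inverse (?x u)) * substitute_odd (odd_tr i j z) (odd_coord j m) +
      E (\<lambda>u. - 1 * (?y u * (inverse (?x u) * inverse (?x u)))) * substitute_odd (odd_tr i j z) (odd_coord j l)"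
    unfolding E_def
  proof (rule pullback_two_terms[where U = U])
    show "smooth U (\<lambda>u. - 1 * (?y u * (inverse (?x u) * inverse (?x u))))"
      by (intro smooths)
  qed (auto simp: even U intro: smooth, auto simp: U_def odd_tr_nth glued_odd_def m_def)
  also have "\<dots> = V * ?H m - ?W m * (V * V) * ?H l"
    using smooth E_mult[OF smooth_const[of U "-1"] smooth_mult[OF U(1) smooth(2) smooth_mult[OF U(1) smooth(3,3)]]]
    by (simp add: substitute_odd_coord[OF ij] E_mult smooth_mult U(1) E_coord V_def[symmetric])
      (simp add: E_def gconst_minus)
  also have "?W m * (V * V) * ?H l = V * V * ?H l * ?W m"
    by (metis even_central[OF even_glued_even] mult.assoc)
  finally show ?odd
    using glue(2) odd_tr_nth[OF il] by (simp add: m_def)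
qed

section \<open>Determinants with a single contributing permutation\<close>

text \<open>
  Outside one exceptional row each row has a single nonzero entry, in the column that \<open>\<sigma>\<close> prescribes. A
  permutation that contributes to the Leibniz formula agrees with \<open>\<sigma>\<close> on all other rows, hence also on the
  exceptional one, because it is injective.
\<close>

lemma det_single_permutation:
  fixes M :: "'a::comm_ring_1 ^ 'n::finite ^ 'n"
  assumes \<sigma>: "\<sigma> permutes (UNIV :: 'n set)"
    and zero: "\<And>r c. r \<noteq> r0 \<Longrightarrow> c \<noteq> \<sigma> r \<Longrightarrow> M $ r $ c = 0"
  shows "det M = of_int (sign \<sigma>) * (\<Prod>r\<in>UNIV. M $ r $ \<sigma> r)"
proof -
  have "of_int (sign p) * (\<Prod>r\<in>UNIV. M $ r $ p r) = 0" if "p permutes UNIV" "p \<noteq> \<sigma>" for p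
  proof -
    have "\<exists>r. r \<noteq> r0 \<and> p r \<noteq> \<sigma> r"
    proof (rule ccontr)
      assume "\<not> ?thesis"
      then have eq: "p r = \<sigma> r" if "r \<noteq> r0" for r using that by auto
      obtain s where s: "\<sigma> s = p r0" using permutes_surj[OF \<sigma>] by (metis surjD)
      have "s = r0"
        using eq[of s] s permutes_inj[OF that(1)] by (metis injD)
      with eq s have "p = \<sigma>" by (metis ext)
      with that(2) show False by simp
    qed
    then obtain r where "M $ r $ p r = 0" using zero by blast
    then have "(\<Prod>r\<in>UNIV. M $ r $ p r) = 0" by (intro prod_zero) auto
    then show ?thesis by simp
  qed
  then have "det M = (\<Sum>p\<in>{\<sigma>}. of_int (sign p) * (\<Prod>r\<in>UNIV. M $ r $ p r))"
    unfolding det_def using \<sigma> by (intro sum.mono_neutral_right) auto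
  then show ?thesis by simp
qed

lemma of_even_prod_const: "(\<Prod>r\<in>A. even_const (e r)) = even_const (\<Prod>r\<in>A. e r)"
  by (induction A rule: infinite_finite_induct) (auto simp: even_const_1 even_const_mult)

lemma even_const_minus: "even_const (- c) = - even_const c"
  by transfer (rule gconst_minus)

lemma to_even_gconst: "to_even (gconst c) = even_const c"
  by (transfer, rule grassmann_eqI) (simp add: gconst.rep_eq)

lemma even_det_single_permutation:
  fixes X :: "'q::finite grassmann ^ 'n::finite ^ 'n"
  assumes \<sigma>: "\<sigma> permutes (UNIV :: 'n set)"
    and zero: "\<And>r c. r \<noteq> r0 \<Longrightarrow> c \<noteq> \<sigma> r \<Longrightarrow> X $ r $ c = 0"
    and pivot: "\<And>r. X $ r $ \<sigma> r = gconst (e r)"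
  shows "even_det X = gconst (of_int (sign \<sigma>) * (\<Prod>r\<in>UNIV. e r))"
proof -
  have "to_even (0 :: 'q grassmann) = 0"
    by (transfer, rule grassmann_eqI) (simp add: zero_grassmann.rep_eq)
  then have "det (\<chi> i j. to_even (X $ i $ j)) =
      of_int (sign \<sigma>) * (\<Prod>r\<in>UNIV. (\<chi> i j. to_even (X $ i $ j)) $ r $ \<sigma> r)"
    by (intro det_single_permutation[OF \<sigma>, of r0]) (simp add: zero)
  also have "\<dots> = even_const (of_int (sign \<sigma>) * (\<Prod>r\<in>UNIV. e r))"
  proof -
    have "of_int (sign \<sigma>) = (even_const (of_int (sign \<sigma>)) :: 'q even_grassmann)"
      by (simp add: sign_def even_const_1 even_const_minus)
    then show ?thesis by (simp add: pivot to_even_gconst of_even_prod_const even_const_mult)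
  qed
  finally show ?thesis by (simp add: even_det_def even_const.rep_eq)
qed

lemma ginverse_gconst:
  assumes "c \<noteq> 0"
  shows "ginverse (gconst c :: 'q::finite grassmann) = gconst (inverse c)"
proof -
  have inv: "gconst c * gconst (inverse c) = (1 :: 'q grassmann)"
    "gconst (inverse c) * gconst c = (1 :: 'q grassmann)"
    using assms by (simp_all flip: gconst_mult)
  show ?thesis
    unfolding ginverse_def
  proof (rule the_equality)
    show "gconst c * gconst (inverse c) = (1 :: 'q grassmann) \<and> gconst (inverse c) * gconst c = (1 :: 'q grassmann)"
      by (intro conjI inv)
    fix y :: "'q grassmann" assume "gconst c * y = 1 \<and> y * gconst c = 1"
    then show "y = gconst (inverse c)" by (metis inv mult.assoc mult_1_left mult_1_right)
  qed
qed

text \<open>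
  If \<open>A\<close> and \<open>D - C A\<^sup>-\<^sup>1 B\<close> both have the shape above, with the same \<open>\<sigma>\<close> and the same invertible entries
  along it, then their determinants are the same unit. The labelling of rows and columns contributes
  the same \<open>sign \<sigma>\<close> to both.
\<close>

lemma Ber_eq_1:
  fixes X :: "'q::finite grassmann ^ ('n::finite + 'n) ^ ('n + 'n)"
  defines "A \<equiv> super_block Inl Inl X" and "B \<equiv> super_block Inl Inr X"
    and "C \<equiv> super_block Inr Inl X" and "D \<equiv> super_block Inr Inr X"
  defines "D' \<equiv> D - C ** matrix_inv A ** B"
  assumes \<sigma>: "\<sigma> permutes (UNIV :: 'n set)"
    and A: "\<And>r c. r \<noteq> exceptional \<Longrightarrow> c \<noteq> \<sigma> r \<Longrightarrow> A $ r $ c = 0" "\<And>r. A $ r $ \<sigma> r = gconst (e r)"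
    and D': "\<And>r c. r \<noteq> exceptional \<Longrightarrow> c \<noteq> \<sigma> r \<Longrightarrow> D' $ r $ c = 0" "\<And>r. D' $ r $ \<sigma> r = gconst (e r)"
    and e: "\<And>r. e r \<noteq> 0"
  shows "Ber X = 1"
proof -
  let ?d = "of_int (sign \<sigma>) * (\<Prod>r\<in>UNIV. e r) :: complex"
  have d: "even_det A = gconst ?d" "even_det D' = gconst ?d"
    using even_det_single_permutation[OF \<sigma> A] even_det_single_permutation[OF \<sigma> D'] by auto
  have "?d \<noteq> 0" using e by (simp add: sign_def)
  then have "gconst ?d * ginverse (gconst ?d) = (1 :: 'q grassmann)"
    unfolding ginverse_gconst[OF \<open>?d \<noteq> 0\<close>] gconst_mult[symmetric] right_inverse[OF \<open>?d \<noteq> 0\<close>]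
    by simp
  then show ?thesis
    using d by (simp add: Ber_def Let_def A_def B_def C_def D_def D'_def)
qed

section \<open>The super Jacobian of a change of charts\<close>

lemma even_partial_two_terms:
  assumes "open U" "z \<in> U" "smooth U f" "smooth U g"
    and "\<And>u. u \<in> U \<Longrightarrow> F u = gconst (f u) * x + gconst (g u) * y"
  shows "even_partial k F z = gconst (partial k f z) * x + gconst (partial k g z) * y"
proof (rule grassmann_eqI)
  fix S
  have "partial k (\<lambda>u. gcoeff (F u) S) z = partial k (\<lambda>u. f u * gcoeff x S + g u * gcoeff y S) z"
    by (rule partial_cong[OF assms(1) _ assms(2)]) (simp add: assms(5) plus_grassmann.rep_eq)
  also have "\<dots> = partial k f z * gcoeff x S + partial k g z * gcoeff y S"
  proof -
    have "partial k (\<lambda>u. h u * c) z = partial k h z * c" if "smooth U h" for h c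
      by (subst partial_mult) (auto intro!: smooth_differentiable that smooth_const assms)
    then show ?thesis
      using assms by (subst partial_add) (auto intro!: smooth_differentiable smooth_mult smooth_const)
  qed
  finally show "gcoeff (even_partial k F z) S =
      gcoeff (gconst (partial k f z) * x + gconst (partial k g z) * y) S"
    by (simp add: even_partial_def plus_grassmann.rep_eq)
qed

lemma odd_partial_two_terms:
  assumes "F z = gconst c * x + gconst d * y"
  shows "odd_partial a F z = gconst c * odd_partial a (\<lambda>_. x) z + gconst d * odd_partial a (\<lambda>_. y) z"
  by (rule grassmann_eqI) (simp add: odd_partial_def assms plus_grassmann.rep_eq algebra_simps)

lemma odd_partial_0 [simp]: "odd_partial a (\<lambda>_. 0) z = 0"
  by (rule grassmann_eqI) (simp add: odd_partial_def zero_grassmann.rep_eq)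

lemma odd_partial_1 [simp]: "odd_partial a (\<lambda>_. 1) z = 0"
  by (rule grassmann_eqI) (simp add: odd_partial_def zero_grassmann.rep_eq one_grassmann.rep_eq)

lemma inversions_self [simp]: "inversions {a} {a} = 0"
  by (auto simp: inversions_def card_eq_0_iff)

lemma odd_partial_theta [simp]: "odd_partial a (\<lambda>_. theta b) z = (if a = b then 1 else 0)"
  by (rule grassmann_eqI)
    (auto simp: odd_partial_def zero_grassmann.rep_eq one_grassmann.rep_eq theta.rep_eq inversion_sign_def)

lemma odd_partial_minus: "odd_partial a (\<lambda>_. - x) z = - odd_partial a (\<lambda>_. x) z"
  by (rule grassmann_eqI) (simp add: odd_partial_def uminus_grassmann.rep_eq)

lemma gcoeff_theta_mult:
  "gcoeff (theta a * x) S = (if a \<in> S then inversion_sign {a} (S - {a}) * gcoeff x (S - {a}) else 0)"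
proof -
  have "gcoeff (theta a * x) S =
      (\<Sum>T\<in>Pow S. if T = {a} then inversion_sign {a} (S - {a}) * gcoeff x (S - {a}) else 0)"
    unfolding times_grassmann.rep_eq theta.rep_eq by (rule sum.cong) auto
  then show ?thesis by auto
qed

lemma inversion_sign_square:
  "inversion_sign A B * inversion_sign A B = 1" "inversion_sign A B * (inversion_sign A B * c) = c"
  by (simp_all add: inversion_sign_def mult.assoc[symmetric] flip: power_mult_distrib)

text \<open>
  The graded Leibniz rule for a product of two generators. The case \<open>a = c\<close> is reduced to a derivative by
  the first factor by interchanging the factors.
\<close>

lemma odd_partial_theta_mult:
  fixes a b c :: "'q::finite"
  shows "odd_partial a (\<lambda>_. theta b * theta c) z =
    (if a = b then theta c else 0) - (if a = c then theta b else 0)"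
proof -
  have first: "odd_partial b (\<lambda>_. theta b * theta c) z = theta c" if "b \<noteq> c" for b c :: 'q
    by (rule grassmann_eqI)
      (use that in \<open>auto simp: odd_partial_def gcoeff_theta_mult inversion_sign_square theta.rep_eq\<close>)
  consider "b = c" | "b \<noteq> c" "a = b" | "b \<noteq> c" "a = c" | "b \<noteq> c" "a \<noteq> b" "a \<noteq> c" by blast
  then show ?thesis
  proof cases
    case 3
    then show ?thesis
      by (simp add: odd_anticommute[of "theta b" "theta c"] odd_partial_minus first)
  next
    case 4
    then show ?thesis
      by (intro grassmann_eqI)
        (auto simp: odd_partial_def gcoeff_theta_mult theta.rep_eq zero_grassmann.rep_eq)
  qed (simp_all add: odd_square first)
qed

lemma partial_chart_coord: "partial k (\<lambda>u. chart_coord i u l) z = (if chart_label i k = l then 1 else 0)"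
  by (cases l i rule: chart_label_cases) (auto simp: inj_eq[OF inj_chart_label])

lemma super_jacobian_nth:
  "super_jacobian w \<eta> z $ Inl k $ Inl l = even_partial k (\<lambda>u. w u $ l) z"
  "super_jacobian w \<eta> z $ Inl k $ Inr b = even_partial k (\<lambda>u. \<eta> u $ b) z"
  "super_jacobian w \<eta> z $ Inr a $ Inl l = odd_partial a (\<lambda>u. w u $ l) z"
  "super_jacobian w \<eta> z $ Inr a $ Inr b = odd_partial a (\<lambda>u. \<eta> u $ b) z"
  by (simp_all add: super_jacobian_def)

abbreviation "transition_jacobian i j \<equiv> super_jacobian (even_tr i j) (odd_tr i j)"

text \<open>
  The super Jacobian in closed form, with \<open>v = 1 / z\<^bsub>ji\<^esub>\<close> and \<open>\<delta> k l = \<partial>z\<^bsub>li\<^esub> / \<partial>z\<^sub>k\<close>, where \<open>z\<^sub>k\<close> is the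
  \<open>k\<close>-th coordinate of the \<open>i\<close>-th chart.
\<close>

lemma transition_jacobian_nth:
  fixes z :: "complex ^ 'n::finite"
  assumes "chart_coord i z j \<noteq> 0"
  defines "J \<equiv> transition_jacobian i j z" and "v \<equiv> inverse (chart_coord i z j)"
    and "\<delta> \<equiv> \<lambda>k l. if chart_label i k = l then 1 else 0"
  shows "J $ Inl k $ Inl b =
      gconst (\<delta> k (chart_label j b) * v - chart_coord i z (chart_label j b) * (\<delta> k j * (v * v))) +
      gconst (- 2 * \<delta> k j * (v * v * v)) * (odd_coord i j * odd_coord i (chart_label j b))"
    and "J $ Inl k $ Inr b =
      gconst (- \<delta> k j * (v * v)) * odd_coord i (chart_label j b) +
      gconst (- \<delta> k (chart_label j b) * (v * v) +
         2 * chart_coord i z (chart_label j b) * \<delta> k j * (v * v * v)) * odd_coord i j"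
    and "J $ Inr a $ Inl b =
      gconst (v * v) * odd_partial a (\<lambda>_. odd_coord i j * odd_coord i (chart_label j b)) z"
    and "J $ Inr a $ Inr b =
      gconst v * odd_partial a (\<lambda>_. odd_coord i (chart_label j b)) z +
      gconst (- (chart_coord i z (chart_label j b) * (v * v))) * odd_partial a (\<lambda>_. odd_coord i j) z"
proof -
  define U where "U = {u :: complex ^ 'n. chart_coord i u j \<noteq> 0}"
  define l where "l = chart_label j b"
  let ?x = "\<lambda>u. chart_coord i u j" and ?y = "\<lambda>u. chart_coord i u l"
  have U: "open U" "z \<in> U"
    using assms(1) open_chart_coord_nonzero by (auto simp: U_def)
  have smooth: "smooth U ?x" "smooth U ?y" "smooth U (\<lambda>u. inverse (?x u))"
    by (auto simp: U_def intro!: smooth_chart_coord smooth_inverse open_chart_coord_nonzero)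
  note smooths = smooth smooth_mult U(1) smooth_const
  have diff: "(\<lambda>t. f (z + axis k t)) field_differentiable at 0" if "smooth U f" for f
    using smooth_differentiable[OF that U(2)] .
  have pv: "partial k (\<lambda>u. inverse (?x u)) z = - (\<delta> k j * (v * v))"
    using assms(1) smooth by (subst partial_inverse) (auto intro: diff simp: partial_chart_coord \<delta>_def v_def)
  have pvv: "partial k (\<lambda>u. inverse (?x u) * inverse (?x u)) z = - 2 * \<delta> k j * (v * v * v)"
    by (subst partial_mult) (auto intro!: diff smooths simp: pv v_def[symmetric])
  have pyv: "partial k (\<lambda>u. ?y u * inverse (?x u)) z =
      \<delta> k l * v - chart_coord i z l * (\<delta> k j * (v * v))"
    by (subst partial_mult) (auto intro!: diff smooths simp: pv partial_chart_coord v_def[symmetric] \<delta>_def)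
  have pyvv: "partial k (\<lambda>u. - 1 * (?y u * (inverse (?x u) * inverse (?x u)))) z =
      - \<delta> k l * (v * v) + 2 * chart_coord i z l * \<delta> k j * (v * v * v)"
  proof -
    have "partial k (\<lambda>u. - 1 * (?y u * (inverse (?x u) * inverse (?x u)))) z =
        - 1 * partial k (\<lambda>u. ?y u * (inverse (?x u) * inverse (?x u))) z"
      by (subst partial_mult) (intro diff smooths, intro diff smooths, simp)
    also have "partial k (\<lambda>u. ?y u * (inverse (?x u) * inverse (?x u))) z =
        \<delta> k l * (v * v) + ?y z * (- 2 * \<delta> k j * (v * v * v))"
      by (subst partial_mult) (intro diff smooths, intro diff smooths,
        unfold pvv, simp add: partial_chart_coord v_def \<delta>_def)
    finally show ?thesis by (simp add: algebra_simps)
  qed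
  show "J $ Inl k $ Inl b =
      gconst (\<delta> k (chart_label j b) * v - chart_coord i z (chart_label j b) * (\<delta> k j * (v * v))) +
      gconst (- 2 * \<delta> k j * (v * v * v)) * (odd_coord i j * odd_coord i (chart_label j b))"
  proof -
    have "even_partial k (\<lambda>u. even_tr i j u $ b) z =
        gconst (partial k (\<lambda>u. ?y u * inverse (?x u)) z) * 1 +
        gconst (partial k (\<lambda>u. inverse (?x u) * inverse (?x u)) z) * (odd_coord i j * odd_coord i l)"
      by (rule even_partial_two_terms[OF U]) (intro smooths, intro smooths,
        simp add: U_def even_tr_nth glued_even_def l_def)
    then show ?thesis unfolding pvv pyv by (simp add: J_def super_jacobian_nth l_def)
  qed
  show "J $ Inl k $ Inr b =
      gconst (- \<delta> k j * (v * v)) * odd_coord i (chart_label j b) +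
      gconst (- \<delta> k (chart_label j b) * (v * v) +
         2 * chart_coord i z (chart_label j b) * \<delta> k j * (v * v * v)) * odd_coord i j"
  proof -
    have "even_partial k (\<lambda>u. odd_tr i j u $ b) z =
        gconst (partial k (\<lambda>u. inverse (?x u)) z) * odd_coord i l +
        gconst (partial k (\<lambda>u. - 1 * (?y u * (inverse (?x u) * inverse (?x u)))) z) * odd_coord i j"
      by (rule even_partial_two_terms[OF U]) (intro smooths, intro smooths,
        simp add: U_def odd_tr_nth glued_odd_def l_def)
    then show ?thesis unfolding pv pyvv by (simp add: J_def super_jacobian_nth l_def)
  qed
  have "even_tr i j z $ b = gconst (?y z * v) * 1 + gconst (v * v) * (odd_coord i j * odd_coord i l)"
    by (simp add: even_tr_nth[OF assms(1)] glued_even_def v_def l_def)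
  from odd_partial_two_terms[where F = "\<lambda>u. even_tr i j u $ b", OF this, of a]
  show "J $ Inr a $ Inl b =
      gconst (v * v) * odd_partial a (\<lambda>_. odd_coord i j * odd_coord i (chart_label j b)) z"
    by (simp add: J_def super_jacobian_nth l_def)
  have "odd_tr i j z $ b = gconst v * odd_coord i l + gconst (- (?y z * (v * v))) * odd_coord i j"
    by (simp add: odd_tr_nth[OF assms(1)] glued_odd_def v_def l_def)
  from odd_partial_two_terms[where F = "\<lambda>u. odd_tr i j u $ b", OF this, of a]
  show "J $ Inr a $ Inr b =
      gconst v * odd_partial a (\<lambda>_. odd_coord i (chart_label j b)) z +
      gconst (- (chart_coord i z (chart_label j b) * (v * v))) * odd_partial a (\<lambda>_. odd_coord i j) z"
    by (simp add: J_def super_jacobian_nth l_def)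
qed


section \<open>The Berezinian of a change of charts\<close>

text \<open>
  For \<open>i \<noteq> j\<close>, let \<open>r0\<close> be the position of \<open>z\<^bsub>ji\<^esub>\<close> among the source coordinates and \<open>c0\<close> that of \<open>z\<^bsub>ij\<^esub>\<close> among the
  target coordinates; every other homogeneous index occurs in both charts, and \<open>\<sigma>\<close> matches equal indices
  and \<open>r0\<close> with \<open>c0\<close>. In every row \<open>k \<noteq> r0\<close>, \<open>A\<close> and \<open>D\<close> have the single entry \<open>v\<close> in column \<open>\<sigma> k\<close>, and
  at \<open>(r0, c0)\<close> both have \<open>- v\<^sup>2\<close>. Moreover the rows of \<open>C\<close> are combinations of the rows \<open>k \<noteq> r0\<close> of \<open>A\<close>, that
  is, \<open>C = E A\<close> where the column \<open>r0\<close> of \<open>E\<close> vanishes. So \<open>C A\<^sup>-\<^sup>1 B = E B\<close> involves only the rows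
  \<open>k \<noteq> r0\<close> of \<open>B\<close>, whose single entry is \<open>- v\<^sup>2 \<theta>\<^bsub>ji\<^esub>\<close>. In the rows \<open>a \<noteq> r0\<close> of \<open>E B\<close> this meets the
  factor \<open>\<theta>\<^bsub>ji\<^esub>\<close> of \<open>E\<close> and gives \<open>0\<close>, and the column \<open>c0\<close> of \<open>E B\<close> is zero as well. Hence \<open>E B\<close> changes \<open>D\<close>
  only at places where determinants of this shape do not see it.
\<close>

lemma Ber_transition:
  fixes z :: "complex ^ 'n::finite"
  assumes x: "chart_coord i z j \<noteq> 0"
  shows "Ber (transition_jacobian i j z) = 1"
proof (cases "i = j")
  case True
  have "chart_coord j z j \<noteq> 0" by simp
  note J_nth = transition_jacobian_nth[OF this]
  have "super_block Inr Inl (transition_jacobian i j z) = 0"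
    by (simp add: vec_eq_iff super_block_def J_nth True)
  moreover have "super_block Inl Inl (transition_jacobian i j z) = mat 1"
    "super_block Inr Inr (transition_jacobian i j z) = mat 1"
    by (auto simp: vec_eq_iff super_block_def J_nth True mat_def
        inj_eq[OF inj_chart_label] gconst_minus)
  moreover have "(0 :: 'n grassmann ^ 'n ^ 'n) ** M = 0" for M :: "'n grassmann ^ 'n ^ 'n"
    by (simp add: vec_eq_iff matrix_matrix_mult_def)
  ultimately show ?thesis
    by (intro Ber_eq_1[where \<sigma> = id and e = "\<lambda>_. 1"]) (auto simp: permutes_id mat_def)
next
  case False
  obtain r0 where j: "j = chart_label i r0"
    using False chart_label_cases[of j i] by metis
  obtain c0 where i: "i = chart_label j c0"
    using False chart_label_cases[of i j] by metis
  define \<sigma> where "\<sigma> = (\<lambda>k. if k = r0 then c0 else inv (chart_label j) (chart_label i k))"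
  have label: "chart_label j (\<sigma> k) = (if k = r0 then i else chart_label i k)" for k
  proof (cases "k = r0")
    case False
    then have "chart_label i k \<in> range (chart_label j)"
      using j by (simp add: range_chart_label inj_eq[OF inj_chart_label])
    then show ?thesis using False by (simp add: \<sigma>_def f_inv_into_f)
  qed (simp add: \<sigma>_def i[symmetric])
  have inj: "inj \<sigma>"
  proof (rule injI)
    fix k m assume "\<sigma> k = \<sigma> m"
    then have "chart_label j (\<sigma> k) = chart_label j (\<sigma> m)" by simp
    then show "k = m" by (auto simp: label inj_eq[OF inj_chart_label] split: if_splits)
  qed
  then have bij: "bij \<sigma>" by (simp add: bij_def finite_UNIV_inj_surj)
  then have \<sigma>: "\<sigma> permutes UNIV" by (intro bij_imp_permutes) auto
  have column: "\<exists>m. b = \<sigma> m" for b using bij by (metis bij_def surjD)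
  have sum_\<sigma>: "(\<Sum>b\<in>UNIV. f b) = (\<Sum>m\<in>UNIV. f (\<sigma> m))" for f :: "'n \<Rightarrow> 'n grassmann"
    by (rule sum.reindex_bij_betw[OF bij, symmetric])

  define v where "v = inverse (chart_coord i z j)"
  have v: "v \<noteq> 0" using x by (simp add: v_def)
  define J where "J = transition_jacobian i j z"
  define A B C D where "A = super_block Inl Inl J" and "B = super_block Inl Inr J"
    and "C = super_block Inr Inl J" and "D = super_block Inr Inr J"
  note J_nth = transition_jacobian_nth[OF x, folded J_def v_def]
  note block_nth = super_block_def J_nth label j[symmetric] inj_eq[OF inj_chart_label]
  have oj: "odd_coord i j = theta r0" by (simp add: j)
  have A_row: "A $ k $ \<sigma> m = (if k = m then gconst v else 0)" if "k \<noteq> r0" for k m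
    using that unfolding A_def by (auto simp: block_nth) (simp_all add: j inj_eq[OF inj_chart_label])
  have A_pivot: "A $ r0 $ \<sigma> r0 = gconst (- (v * v))"
    unfolding A_def by (simp add: block_nth)
  have B_row: "B $ k $ \<sigma> m = (if k = m then gconst (- (v * v)) * theta r0 else 0)" if "k \<noteq> r0" for k m
    using that unfolding B_def by (auto simp: block_nth) (simp_all add: j inj_eq[OF inj_chart_label])
  have C_nth: "C $ a $ \<sigma> m = (if m = r0 then 0 else gconst (v * v) *
      ((if a = r0 then theta m else 0) - (if a = m then theta r0 else 0)))" for a m
    unfolding C_def by (simp add: block_nth oj odd_partial_theta_mult)
  have D_row: "D $ k $ \<sigma> m = (if k = m then gconst v else 0)" if "k \<noteq> r0" for k m
    using that unfolding D_def by (simp add: block_nth oj)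
  have D_pivot: "D $ r0 $ \<sigma> r0 = gconst (- (v * v))"
    unfolding D_def by (simp add: block_nth oj)

  \<comment> \<open>The inverse of \<open>A\<close>, obtained by eliminating the row \<open>r0\<close> of \<open>A\<close> with the help of the other rows.\<close>
  define A' :: "'n grassmann ^ 'n ^ 'n" where
    "A' = (\<chi> b k. if b = \<sigma> r0
       then if k = r0 then gconst (- (inverse v * inverse v))
            else gconst (inverse v * inverse v * inverse v) * A $ r0 $ \<sigma> k
       else if b = \<sigma> k then gconst (inverse v) else 0)"
  have A'_nth: "A' $ \<sigma> m $ k = (if m = r0
       then if k = r0 then gconst (- (inverse v * inverse v))
            else gconst (inverse v * inverse v * inverse v) * A $ r0 $ \<sigma> k
       else if m = k then gconst (inverse v) else 0)" for m k
    by (simp add: A'_def inj_eq[OF inj])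
  have unit: "gconst a * gconst b = (1 :: 'n grassmann)" if "a * b = 1" for a b
    using that by (simp flip: gconst_mult)
  have unit_pivot: "gconst (- (v * v)) * gconst (- (inverse v * inverse v)) = (1 :: 'n grassmann)"
    "gconst (- (inverse v * inverse v)) * gconst (- (v * v)) = (1 :: 'n grassmann)"
    using v by (auto intro!: unit simp: field_simps)
  have gconst_gconst: "gconst a * (gconst b * y) = gconst (a * b) * y" for a b and y :: "'n grassmann"
    by (simp add: gconst_mult mult.assoc)
  have AA': "A ** A' = mat 1"
  proof -
    have "(\<Sum>m\<in>UNIV. A $ k $ \<sigma> m * A' $ \<sigma> m $ k') = (if k = k' then 1 else 0)" for k k'
    proof (cases "k = r0")
      case True
      let ?p = "gconst (- (v * v)) * A' $ \<sigma> r0 $ k'"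
      let ?q = "if k' = r0 then 0 else A $ r0 $ \<sigma> k' * gconst (inverse v)"
      have "(\<Sum>m\<in>UNIV. A $ k $ \<sigma> m * A' $ \<sigma> m $ k') =
          (\<Sum>m\<in>UNIV. (if m = r0 then ?p else 0) + (if m = k' then ?q else 0))"
        by (rule sum.cong) (auto simp: True A_pivot A'_nth)
      also have "\<dots> = ?p + ?q" by (simp add: sum.distrib)
      also have "\<dots> = (if k = k' then 1 else 0)"
      proof (cases "k' = r0")
        case False
        have "gconst (- (v * v)) * (gconst (inverse v * inverse v * inverse v) * A $ r0 $ \<sigma> k') =
            gconst (- inverse v) * A $ r0 $ \<sigma> k'"
          unfolding gconst_gconst using v by (simp add: field_simps)
        then show ?thesis using False True
          by (simp add: A'_nth gconst_commute[of "A $ r0 $ \<sigma> k'"] gconst_minus)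
      qed (use v True in \<open>simp add: A'_nth unit_pivot\<close>)
      finally show ?thesis .
    next
      case False
      then have "(\<Sum>m\<in>UNIV. A $ k $ \<sigma> m * A' $ \<sigma> m $ k') =
          (\<Sum>m\<in>UNIV. if m = k then gconst v * A' $ \<sigma> k $ k' else 0)"
        by (intro sum.cong) (auto simp: A_row)
      also have "\<dots> = (if k = k' then 1 else 0)" using False v by (simp add: A'_nth unit)
      finally show ?thesis .
    qed
    then have "(A ** A') $ k $ k' = mat 1 $ k $ k'" for k k'
      using sum_\<sigma>[of "\<lambda>b. A $ k $ b * A' $ b $ k'"] by (simp add: matrix_matrix_mult_def mat_def)
    then show ?thesis by (simp add: vec_eq_iff)
  qed
  have A'A: "A' ** A = mat 1"
  proof -
    have "(\<Sum>k\<in>UNIV. A' $ \<sigma> m $ k * A $ k $ \<sigma> m') = (if m = m' then 1 else 0)" for m m'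
    proof (cases "m = r0")
      case True
      let ?p = "gconst (- (inverse v * inverse v)) * A $ r0 $ \<sigma> m'"
      let ?q = "if m' = r0 then 0 else gconst (inverse v * inverse v * inverse v) * A $ r0 $ \<sigma> m' * gconst v"
      have "(\<Sum>k\<in>UNIV. A' $ \<sigma> m $ k * A $ k $ \<sigma> m') =
          (\<Sum>k\<in>UNIV. (if k = r0 then ?p else 0) + (if k = m' then ?q else 0))"
        by (rule sum.cong) (auto simp: True A_row A'_nth)
      also have "\<dots> = ?p + ?q" by (simp add: sum.distrib)
      also have "\<dots> = (if m = m' then 1 else 0)"
      proof (cases "m' = r0")
        case False
        have "gconst v * (gconst (inverse v * inverse v * inverse v) * A $ r0 $ \<sigma> m') =
            gconst (inverse v * inverse v) * A $ r0 $ \<sigma> m'"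
          unfolding gconst_gconst using v by (simp add: field_simps)
        then show ?thesis using False True
          by (simp add: gconst_commute[of "_ * A $ r0 $ \<sigma> m'"] gconst_minus)
      qed (use v True in \<open>simp add: A_pivot unit_pivot\<close>)
      finally show ?thesis .
    next
      case False
      then have "(\<Sum>k\<in>UNIV. A' $ \<sigma> m $ k * A $ k $ \<sigma> m') =
          (\<Sum>k\<in>UNIV. if k = m then gconst (inverse v) * A $ m $ \<sigma> m' else 0)"
        by (intro sum.cong) (auto simp: A'_nth)
      also have "\<dots> = (if m = m' then 1 else 0)" using False v by (simp add: A_row unit)
      finally show ?thesis .
    qed
    then have "(A' ** A) $ \<sigma> m $ \<sigma> m' = mat 1 $ \<sigma> m $ \<sigma> m'" for m m'
      by (simp add: matrix_matrix_mult_def mat_def inj_eq[OF inj])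
    then show ?thesis unfolding vec_eq_iff by (metis column)
  qed

  \<comment> \<open>Rows \<open>a \<noteq> r0\<close> of \<open>C\<close> are \<open>- v \<theta>\<^bsub>ji\<^esub>\<close> times the row \<open>a\<close> of \<open>A\<close>, and the row \<open>r0\<close> of \<open>C\<close> is the sum over \<open>k \<noteq> r0\<close> of \<open>v \<theta>\<^sub>k\<close> times the row \<open>k\<close> of \<open>A\<close>.\<close>
  define E :: "'n grassmann ^ 'n ^ 'n" where
    "E = (\<chi> a k. if k = r0 then 0 else if a = r0 then gconst v * theta k
       else if a = k then gconst (- v) * theta r0 else 0)"
  have E_nth: "E $ a $ k = (if k = r0 then 0 else if a = r0 then gconst v * theta k
       else if a = k then gconst (- v) * theta r0 else 0)" for a k
    by (simp add: E_def)
  have E_mult: "(E ** M) $ a $ \<sigma> m = (if m = r0 then 0 else E $ a $ m * c)"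
    if "\<And>k m. k \<noteq> r0 \<Longrightarrow> M $ k $ \<sigma> m = (if k = m then c else 0)" for M :: "'n grassmann ^ 'n ^ 'n" and c a m
  proof -
    have "(\<Sum>k\<in>UNIV. E $ a $ k * M $ k $ \<sigma> m) =
        (\<Sum>k\<in>UNIV. if k = m then (if m = r0 then 0 else E $ a $ m * c) else 0)"
      using that by (intro sum.cong) (auto simp: E_nth)
    then show ?thesis by (simp add: matrix_matrix_mult_def)
  qed
  have EA: "(E ** A) $ a $ \<sigma> m = (if m = r0 then 0 else E $ a $ m * gconst v)" for a m
    by (rule E_mult) (rule A_row)
  have EB: "(E ** B) $ a $ \<sigma> m = (if m = r0 then 0 else E $ a $ m * (gconst (- (v * v)) * theta r0))" for a m
    by (rule E_mult) (rule B_row)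
  have gconst_theta_gconst: "gconst a * theta b * gconst c = gconst (a * c) * theta b" for a c and b :: 'n
    by (simp add: gconst_commute[of "gconst a * theta b"] gconst_gconst mult.commute)
  have "(E ** A) $ a $ \<sigma> m = C $ a $ \<sigma> m" for a m
    unfolding EA C_nth E_nth
    by (auto simp: gconst_theta_gconst gconst_minus)
  then have "C = E ** A" unfolding vec_eq_iff by (metis column)
  then have "C ** matrix_inv A = E"
    using matrix_inv_eqI[OF AA' A'A] AA' by (simp add: matrix_mul_assoc[symmetric])
  moreover have "(E ** B) $ a $ \<sigma> m = 0" if "a \<noteq> r0 \<or> m = r0" for a m
  proof -
    have "theta r0 * (gconst (- (v * v)) * theta r0) = (0 :: 'n grassmann)"
      by (metis gconst_commute mult.assoc mult_zero_right odd_square odd_theta)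
    then show ?thesis
      using that unfolding EB E_nth by (auto simp: mult.assoc)
  qed
  ultimately have D': "(D - C ** matrix_inv A ** B) $ a $ \<sigma> m = D $ a $ \<sigma> m" if "a \<noteq> r0 \<or> m = r0" for a m
    using that by simp
  show ?thesis
    unfolding J_def[symmetric]
  proof (rule Ber_eq_1[where X = J and \<sigma> = \<sigma> and e = "\<lambda>k. if k = r0 then - (v * v) else v" and exceptional = r0, OF \<sigma>,
        folded A_def B_def C_def D_def])
    fix r c assume rc: "r \<noteq> r0" "c \<noteq> \<sigma> r"
    then obtain m where "c = \<sigma> m" "m \<noteq> r" using column[of c] by auto
    then show "A $ r $ c = 0" "(D - C ** matrix_inv A ** B) $ r $ c = 0"
      using rc D' by (simp_all add: A_row D_row)
  next
    fix r
    show "A $ r $ \<sigma> r = gconst (if r = r0 then - (v * v) else v)"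
      by (simp add: A_row A_pivot)
    show "(D - C ** matrix_inv A ** B) $ r $ \<sigma> r = gconst (if r = r0 then - (v * v) else v)"
      by (subst D') (auto simp: D_row D_pivot)
    show "(if r = r0 then - (v * v) else v) \<noteq> 0" using v by simp
  qed
qed

section \<open>The topology of projective space\<close>

lemma mem_line: "w \<in> line v \<longleftrightarrow> (\<exists>c. w = c *s v)"
  by (auto simp: line_def)

lemma line_scale:
  fixes v :: "complex ^ 'm"
  assumes "c \<noteq> 0"
  shows "line (c *s v) = line v"
proof (rule set_eqI)
  fix w
  have "a *s v = (a / c) *s (c *s v)" for a using assms by (simp add: vector_smult_assoc)
  then show "w \<in> line (c *s v) \<longleftrightarrow> w \<in> line v"
    unfolding mem_line by (metis vector_smult_assoc)
qed

lemma line_eqD: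
  fixes v w :: "complex ^ 'm"
  assumes "line v = line w" "v \<noteq> 0"
  obtains c where "c \<noteq> 0" "v = c *s w"
proof -
  have "v \<in> line v" by (auto simp: mem_line intro: exI[of _ 1])
  then obtain c where "v = c *s w" using assms(1) by (auto simp: mem_line)
  with assms(2) that show ?thesis by (cases "c = 0") auto
qed

lemma openin_projective:
  "openin projective_topology V \<longleftrightarrow>
    V \<subseteq> line ` (UNIV - {0}) \<and> open {v :: complex ^ 'm::finite. v \<noteq> 0 \<and> line v \<in> V}"
proof -
  let ?P = "\<lambda>V. V \<subseteq> line ` (UNIV - {0}) \<and> open {v :: complex ^ 'm. v \<noteq> 0 \<and> line v \<in> V}"
  have "istopology ?P"
    unfolding istopology_def
  proof (intro conjI allI impI)
    fix S T :: "(complex ^ 'm) set set" assume "?P S" "?P T"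
    moreover have "{v. v \<noteq> 0 \<and> line v \<in> S \<inter> T} = {v. v \<noteq> 0 \<and> line v \<in> S} \<inter> {v. v \<noteq> 0 \<and> line v \<in> T}"
      by auto
    ultimately show "S \<inter> T \<subseteq> line ` (UNIV - {0})" "open {v. v \<noteq> 0 \<and> line v \<in> S \<inter> T}"
      by (auto simp only: open_Int intro: open_Int)
  next
    fix \<K> :: "(complex ^ 'm) set set set" assume K: "\<forall>K\<in>\<K>. ?P K"
    have "{v. v \<noteq> 0 \<and> line v \<in> \<Union>\<K>} = (\<Union>K\<in>\<K>. {v. v \<noteq> 0 \<and> line v \<in> K})" by auto
    with K show "\<Union>\<K> \<subseteq> line ` (UNIV - {0})" "open {v. v \<noteq> 0 \<and> line v \<in> \<Union>\<K>}" by auto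
  qed
  then show ?thesis unfolding projective_topology_def by simp
qed

lemma topspace_projective: "topspace projective_topology = line ` (UNIV - {0 :: complex ^ 'm::finite})"
proof
  show "topspace projective_topology \<subseteq> line ` (UNIV - {0 :: complex ^ 'm})"
    using openin_topspace[of "projective_topology :: (complex ^ 'm) set topology"]
    unfolding openin_projective by blast
  have "{v :: complex ^ 'm. v \<noteq> 0 \<and> line v \<in> line ` (UNIV - {0})} = - {0}" by auto
  then have "openin projective_topology (line ` (UNIV - {0 :: complex ^ 'm}))"
    unfolding openin_projective by (simp add: open_Compl)
  then show "line ` (UNIV - {0 :: complex ^ 'm}) \<subseteq> topspace projective_topology"
    by (rule openin_subset)
qed

text \<open>
  The universal property of the quotient topology, in the form in which it is used to separate points.
\<close>

lemma continuous_map_from_projective: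
  fixes f :: "(complex ^ 'm::finite) set \<Rightarrow> 'b::topological_space"
  assumes "continuous_on (UNIV - {0}) (\<lambda>v. f (line v))"
  shows "continuous_map projective_topology euclidean f"
  unfolding continuous_map_def openin_projective
proof (intro conjI allI impI)
  fix U :: "'b set" assume "openin euclidean U"
  then have "open ((\<lambda>v. f (line v)) -` U \<inter> (UNIV - {0}))"
    using assms by (subst (asm) continuous_on_open_vimage) (auto simp: open_Diff)
  moreover have "{v. v \<noteq> 0 \<and> line v \<in> {x \<in> topspace projective_topology. f x \<in> U}} =
      (\<lambda>v. f (line v)) -` U \<inter> (UNIV - {0})"
    by (auto simp: topspace_projective)
  ultimately show "open {v. v \<noteq> 0 \<and> line v \<in> {x \<in> topspace projective_topology. f x \<in> U}}" by simp
qed (auto simp: topspace_projective)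

definition hermitian_square :: "complex ^ 'm::finite \<Rightarrow> complex" where
  "hermitian_square v = (\<Sum>l\<in>UNIV. v $ l * cnj (v $ l))"

text \<open>
  The orthogonal projection \<open>v v\<^sup>* / |v|\<^sup>2\<close> onto the line of \<open>v\<close>. It depends continuously on \<open>v\<close> and only on
  the line of \<open>v\<close>, and it determines the line; so it maps projective space injectively into a space of matrices.
\<close>

definition line_projector :: "complex ^ 'm::finite \<Rightarrow> complex ^ 'm ^ 'm" where
  "line_projector v = (\<chi> a b. v $ a * cnj (v $ b) / hermitian_square v)"

lemma hermitian_square_nonzero:
  assumes "v \<noteq> 0"
  shows "hermitian_square v \<noteq> 0"
proof -
  obtain l where "v $ l \<noteq> 0" using assms by (auto simp: vec_eq_iff)
  then have "(\<Sum>l\<in>UNIV. (cmod (v $ l))\<^sup>2) > 0"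
    by (intro sum_pos2[of _ l]) auto
  moreover have "hermitian_square v = of_real (\<Sum>l\<in>UNIV. (cmod (v $ l))\<^sup>2)"
    unfolding hermitian_square_def of_real_sum by (intro sum.cong refl) (simp only: complex_norm_square)
  ultimately show ?thesis by (metis of_real_eq_0_iff less_irrefl)
qed

lemma line_projector_scale:
  assumes "c \<noteq> 0"
  shows "line_projector (c *s v) = line_projector v"
proof -
  have "hermitian_square (c *s v) = c * cnj c * hermitian_square v"
    by (simp add: hermitian_square_def sum_distrib_left mult_ac)
  then show ?thesis using assms by (simp add: line_projector_def vec_eq_iff field_simps)
qed

lemma line_eqI_projector:
  assumes "v \<noteq> 0" "w \<noteq> 0" "line_projector v = line_projector w"
  shows "line v = line w"
proof -
  obtain b where b: "v $ b \<noteq> 0" using assms(1) by (auto simp: vec_eq_iff)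
  have eq: "v $ a * cnj (v $ b) / hermitian_square v = w $ a * cnj (w $ b) / hermitian_square w" for a
    using assms(3) by (simp add: line_projector_def vec_eq_iff)
  note nonzero = hermitian_square_nonzero[OF assms(1)] hermitian_square_nonzero[OF assms(2)]
  have wb: "w $ b \<noteq> 0" using eq[of b] b nonzero by auto
  define c where "c = cnj (w $ b) * hermitian_square v / (cnj (v $ b) * hermitian_square w)"
  have "c \<noteq> 0" using b wb nonzero by (simp add: c_def)
  moreover have "v = c *s w"
    using eq b nonzero by (simp add: vec_eq_iff c_def field_simps)
  ultimately show ?thesis by (simp add: line_scale)
qed

lemma Hausdorff_projective: "Hausdorff_space (projective_topology :: (complex ^ 'm::finite) set topology)"
proof (rule Hausdorff_space_injective_preimage)
  let ?f = "\<lambda>L :: (complex ^ 'm) set. line_projector (SOME v. v \<noteq> 0 \<and> line v = L)"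
  have f_line: "?f (line v) = line_projector v" if "v \<noteq> 0" for v :: "complex ^ 'm"
  proof -
    let ?w = "SOME w. w \<noteq> 0 \<and> line w = line v"
    have "?w \<noteq> 0 \<and> line ?w = line v" by (rule someI[of _ v]) (use that in simp)
    then show ?thesis using line_scale line_projector_scale by (metis line_eqD)
  qed
  have "continuous_on (UNIV - {0}) (line_projector :: complex ^ 'm \<Rightarrow> _)"
    unfolding line_projector_def
  proof (intro continuous_intros)
    show "continuous_on (UNIV - {0}) (hermitian_square :: complex ^ 'm \<Rightarrow> _)"
      unfolding hermitian_square_def by (intro continuous_intros)
  qed (use hermitian_square_nonzero in auto)
  then have "continuous_on (UNIV - {0}) (\<lambda>v. ?f (line v))"
    by (rule continuous_on_eq) (simp add: f_line)
  then show "continuous_map projective_topology euclidean ?f"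
    by (rule continuous_map_from_projective)
  show "inj_on ?f (topspace projective_topology)"
    unfolding topspace_projective inj_on_def using line_eqI_projector by (auto simp: f_line)
qed simp

lemma second_countable_euclidean:
  "second_countable (euclidean :: 'a::second_countable_topology topology)"
proof -
  obtain \<B> :: "'a set set" where "countable \<B>" "\<And>C. C \<in> \<B> \<Longrightarrow> open C"
    "\<And>S. open S \<Longrightarrow> \<exists>U. U \<subseteq> \<B> \<and> S = \<Union>U"
    using univ_second_countable by blast
  then show ?thesis unfolding second_countable_def by (intro exI[of _ \<B>]) (force simp: open_openin[symmetric])
qed

text \<open>
  The quotient map is open, because the saturation of an open set is the union of its multiples by
  nonzero scalars. Open continuous images inherit second countability.
\<close>

lemma second_countable_projective:
  "second_countable (projective_topology :: (complex ^ 'm::finite) set topology)"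
proof (rule second_countable_open_map_image)
  let ?X = "top_of_set (UNIV - {0 :: complex ^ 'm})"
  have open_X: "openin ?X U \<longleftrightarrow> open U \<and> U \<subseteq> UNIV - {0}" for U
    by (rule openin_open_eq) (simp add: open_Diff)
  show "second_countable ?X"
    by (intro second_countable_subtopology second_countable_euclidean)
  show "line ` topspace ?X = topspace projective_topology"
    by (simp add: topspace_projective)
  show "continuous_map ?X projective_topology line"
    unfolding continuous_map_def open_X
  proof (intro conjI allI impI)
    fix U assume "openin projective_topology (U :: (complex ^ 'm) set set)"
    then show "open {x \<in> topspace ?X. line x \<in> U}"
      unfolding openin_projective by (simp add: Collect_conj_eq)
  qed (auto simp: topspace_projective)
  show "open_map ?X projective_topology line"
    unfolding open_map_def open_X openin_projective
  proof (intro allI impI conjI)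
    fix U :: "(complex ^ 'm) set" assume U: "open U \<and> U \<subseteq> UNIV - {0}"
    then show "line ` U \<subseteq> line ` (UNIV - {0})" by auto
    have "{v. v \<noteq> 0 \<and> line v \<in> line ` U} = (\<Union>c\<in>- {0}. (\<lambda>v. c *s v) -` U)" (is "?L = ?R")
    proof (rule set_eqI)
      fix v
      show "v \<in> ?L \<longleftrightarrow> v \<in> ?R"
      proof
        assume "v \<in> ?L"
        then obtain u where u: "u \<in> U" "line u = line v" by auto
        then have "u \<noteq> 0" using U by auto
        with u(2) obtain c where "c \<noteq> 0" "u = c *s v" by (rule line_eqD)
        with u(1) show "v \<in> ?R" by auto
      next
        assume "v \<in> ?R"
        then obtain c where c: "c \<noteq> 0" "c *s v \<in> U" by auto
        then have "v \<noteq> 0" using U by auto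
        moreover have "line v \<in> line ` U" using c line_scale[OF c(1), of v] by (metis imageI)
        ultimately show "v \<in> ?L" by simp
      qed
    qed
    moreover have "open ((\<lambda>v. c *s v) -` U)" for c :: complex
      using U unfolding vector_scalar_mult_def by (intro open_vimage) (auto intro!: continuous_intros)
    ultimately show "open {v. v \<noteq> 0 \<and> line v \<in> line ` U}" by auto
  qed
qed

section \<open>Affine charts of projective space\<close>

lemma projective_chart_dom_subset: "projective_chart_dom i \<subseteq> line ` (UNIV - {0})"
  by (auto simp: projective_chart_dom_def)

lemma line_in_chart_dom:
  fixes v :: "complex ^ 'm::finite"
  assumes "v \<noteq> 0"
  shows "line v \<in> projective_chart_dom i \<longleftrightarrow> v $ i \<noteq> 0"
  using assms by (auto simp: projective_chart_dom_def elim!: line_eqD)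

lemma line_in_chart_domI: "v $ i \<noteq> 0 \<Longrightarrow> line v \<in> projective_chart_dom i"
  by (auto simp: projective_chart_dom_def)

lemma projective_chart_line:
  assumes "v $ i \<noteq> 0"
  shows "projective_chart i (line v) = (\<chi> k. v $ chart_label i k / v $ i)"
proof -
  have "(THE w. w \<in> line v \<and> w $ i = 1) = inverse (v $ i) *s v"
  proof (rule the_equality)
    show "inverse (v $ i) *s v \<in> line v \<and> (inverse (v $ i) *s v) $ i = 1"
      using assms by (auto simp: mem_line)
    fix w assume "w \<in> line v \<and> w $ i = 1"
    then obtain c where w: "w = c *s v" and "(c *s v) $ i = 1" unfolding mem_line by blast
    then have "c = inverse (v $ i)" using assms by (simp add: field_simps)
    then show "w = inverse (v $ i) *s v" using w by simp
  qed
  then show ?thesis by (simp add: projective_chart_def vec_eq_iff divide_inverse mult.commute)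
qed

lemma chart_coord_projective_chart:
  assumes "v $ i \<noteq> 0"
  shows "chart_coord i (projective_chart i (line v)) l = v $ l / v $ i"
  by (cases l i rule: chart_label_cases) (use assms in \<open>simp_all add: projective_chart_line\<close>)

text \<open>
  The representative \<open>X\<close> with \<open>X\<^sub>i = 1\<close> of the point with coordinates \<open>z\<close>; followed by \<open>line\<close> it is the inverse
  of the \<open>i\<close>-th chart.
\<close>

definition homogeneous :: "'n::finite option \<Rightarrow> complex ^ 'n \<Rightarrow> complex ^ 'n option" where
  "homogeneous i z = (\<chi> l. chart_coord i z l)"

lemma homogeneous_self [simp]: "homogeneous i z $ i = 1"
  by (simp add: homogeneous_def)

lemma homogeneous_nonzero [simp]: "homogeneous i z \<noteq> 0"
  using homogeneous_self[of i z] by (metis zero_index zero_neq_one)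

lemma projective_chart_homogeneous: "projective_chart i (line (homogeneous i z)) = z"
  by (simp add: projective_chart_line vec_eq_iff) (simp add: homogeneous_def)

lemma homogeneous_projective_chart:
  assumes "v $ i \<noteq> 0"
  shows "line (homogeneous i (projective_chart i (line v))) = line v"
proof -
  have "homogeneous i (projective_chart i (line v)) = inverse (v $ i) *s v"
    using assms by (simp add: vec_eq_iff homogeneous_def chart_coord_projective_chart field_simps)
  then show ?thesis using assms by (simp add: line_scale)
qed

lemma projective_chart_image: "projective_chart i ` projective_chart_dom i = UNIV"
proof -
  have "line (homogeneous i z) \<in> projective_chart_dom i" for z by (simp add: line_in_chart_dom)
  then show ?thesis using projective_chart_homogeneous by (metis UNIV_eq_I imageI)
qed

lemma openin_projective_chart_dom: "openin projective_topology (projective_chart_dom i)"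
proof -
  have "{v :: complex ^ 'a. v \<noteq> 0 \<and> line v \<in> projective_chart_dom i} = (\<lambda>v. v $ i) -` (- {0})"
    by (auto simp: line_in_chart_dom intro: line_in_chart_domI)
  then show ?thesis
    unfolding openin_projective
    using projective_chart_dom_subset by (simp add: open_vimage_vec_nth open_Compl)
qed

lemma projective_chart_homeomorphic:
  fixes i :: "'n::finite option"
  shows "homeomorphic_map (subtopology projective_topology (projective_chart_dom i))
    (top_of_set (projective_chart i ` projective_chart_dom i)) (projective_chart i)"
proof -
  let ?X = "subtopology projective_topology (projective_chart_dom i)"
  let ?g = "\<lambda>z. line (homogeneous i z)"
  have top: "topspace ?X = projective_chart_dom i"
    using openin_subset[OF openin_projective_chart_dom] by auto
  have "continuous_map ?X euclidean (projective_chart i)"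
    unfolding continuous_map_def openin_open_subtopology[OF openin_projective_chart_dom] openin_projective
  proof (intro conjI allI impI)
    fix U :: "(complex ^ 'n) set" assume "openin euclidean U"
    moreover have "continuous_on {v. v $ i \<noteq> 0} (\<lambda>v :: complex ^ 'n option. \<chi> k. v $ chart_label i k / v $ i)"
      by (intro continuous_intros) auto
    moreover have "open {v :: complex ^ 'n option. v $ i \<noteq> 0}"
      by (intro open_Collect_neq continuous_intros)
    ultimately have "open ((\<lambda>v. \<chi> k. v $ chart_label i k / v $ i) -` U \<inter> {v. v $ i \<noteq> 0})"
      by (simp add: continuous_on_open_vimage)
    moreover have "{v. v \<noteq> 0 \<and> line v \<in> {x \<in> topspace ?X. projective_chart i x \<in> U}} =
        (\<lambda>v. \<chi> k. v $ chart_label i k / v $ i) -` U \<inter> {v. v $ i \<noteq> 0}"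
      unfolding top by (auto simp: line_in_chart_dom projective_chart_line intro: line_in_chart_domI)
    ultimately show "open {v. v \<noteq> 0 \<and> line v \<in> {x \<in> topspace ?X. projective_chart i x \<in> U}}"
      by simp
  qed (use projective_chart_dom_subset top in auto)
  moreover have "continuous_map euclidean ?X ?g"
    unfolding continuous_map_in_subtopology
  proof
    show "continuous_map euclidean projective_topology ?g"
      unfolding continuous_map_def
    proof (intro conjI allI impI)
      fix V assume "openin projective_topology (V :: (complex ^ 'n option) set set)"
      then have "open {v. v \<noteq> 0 \<and> line v \<in> V}" by (simp add: openin_projective)
      moreover have "continuous_on UNIV (homogeneous i)"
        unfolding homogeneous_def
      proof (intro continuous_intros)
        show "continuous_on UNIV (\<lambda>z. chart_coord i z l)" for l
          unfolding chart_coord_def by (cases "l = i") (auto intro: continuous_intros)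
      qed
      ultimately have "open (homogeneous i -` {v. v \<noteq> 0 \<and> line v \<in> V})" by (rule open_vimage)
      then show "openin euclidean {x \<in> topspace euclidean. ?g x \<in> V}" by (simp add: vimage_def)
    qed (auto simp: topspace_projective)
  qed (auto simp: line_in_chart_dom)
  moreover have "?g (projective_chart i x) = x" if "x \<in> projective_chart_dom i" for x
    using that homogeneous_projective_chart by (auto simp: projective_chart_dom_def)
  ultimately have "homeomorphic_maps ?X euclidean (projective_chart i) ?g"
    by (simp add: homeomorphic_maps_def top projective_chart_homogeneous)
  then show ?thesis unfolding projective_chart_image using homeomorphic_maps_imp_map by auto
qed

section \<open>Holomorphy of the transition functions\<close>

lemma holomorphic_several_const: "holomorphic_several (\<lambda>_. c) U"
  unfolding holomorphic_several_def by (auto intro!: exI[of _ "\<lambda>_. 0"])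

lemma holomorphic_several_component: "holomorphic_several (\<lambda>z. z $ k) U"
  unfolding holomorphic_several_def
  by (auto intro!: exI[of _ "\<lambda>z. z $ k"] bounded_linear_imp_has_derivative bounded_linear_vec_nth)

lemma holomorphic_several_add:
  assumes "holomorphic_several f U" "holomorphic_several g U"
  shows "holomorphic_several (\<lambda>z. f z + g z) U"
  unfolding holomorphic_several_def
proof
  fix z assume "z \<in> U"
  then obtain D E where "(f has_derivative D) (at z)" "\<forall>c v. D (c *s v) = c * D v"
    "(g has_derivative E) (at z)" "\<forall>c v. E (c *s v) = c * E v"
    using assms unfolding holomorphic_several_def by meson
  then show "\<exists>D. ((\<lambda>z. f z + g z) has_derivative D) (at z) \<and> (\<forall>c v. D (c *s v) = c * D v)"
    by (intro exI[of _ "\<lambda>h. D h + E h"]) (auto intro!: has_derivative_add simp: algebra_simps)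
qed

lemma holomorphic_several_mult:
  assumes "holomorphic_several f U" "holomorphic_several g U"
  shows "holomorphic_several (\<lambda>z. f z * g z) U"
  unfolding holomorphic_several_def
proof
  fix z assume "z \<in> U"
  then obtain D E where "(f has_derivative D) (at z)" "\<forall>c v. D (c *s v) = c * D v"
    "(g has_derivative E) (at z)" "\<forall>c v. E (c *s v) = c * E v"
    using assms unfolding holomorphic_several_def by meson
  then show "\<exists>D. ((\<lambda>z. f z * g z) has_derivative D) (at z) \<and> (\<forall>c v. D (c *s v) = c * D v)"
    by (intro exI[of _ "\<lambda>h. f z * E h + D h * g z"] conjI has_derivative_mult)
      (simp_all add: algebra_simps)
qed

lemma holomorphic_several_inverse:
  assumes "holomorphic_several f U" "\<And>z. z \<in> U \<Longrightarrow> f z \<noteq> 0"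
  shows "holomorphic_several (\<lambda>z. inverse (f z)) U"
  unfolding holomorphic_several_def
proof
  fix z assume z: "z \<in> U"
  then obtain D where "(f has_derivative D) (at z)" "\<forall>c v. D (c *s v) = c * D v"
    using assms unfolding holomorphic_several_def by meson
  then show "\<exists>D. ((\<lambda>z. inverse (f z)) has_derivative D) (at z) \<and> (\<forall>c v. D (c *s v) = c * D v)"
    using assms(2)[OF z]
    by (intro exI[of _ "\<lambda>h. - (inverse (f z) * D h * inverse (f z))"] conjI Deriv.has_derivative_inverse)
      (simp_all add: algebra_simps)
qed

lemma holomorphic_several_cong:
  assumes "open U" "\<And>z. z \<in> U \<Longrightarrow> f z = g z" "holomorphic_several f U"
  shows "holomorphic_several g U"
  unfolding holomorphic_several_def
proof
  fix z assume z: "z \<in> U"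
  then obtain D where D: "(f has_derivative D) (at z)" "\<forall>c v. D (c *s v) = c * D v"
    using assms(3) unfolding holomorphic_several_def by meson
  have "(g has_derivative D) (at z)"
    using has_derivative_transform_within_open[OF D(1) assms(1) z assms(2)] .
  with D(2) show "\<exists>D. (g has_derivative D) (at z) \<and> (\<forall>c v. D (c *s v) = c * D v)" by blast
qed

lemma super_holomorphic_two_terms:
  assumes "open U" "holomorphic_several f U" "holomorphic_several g U"
    and "\<And>u. u \<in> U \<Longrightarrow> F u = gconst (f u) * x + gconst (g u) * y"
  shows "super_holomorphic F U"
  unfolding super_holomorphic_def
proof
  fix S
  have "holomorphic_several (\<lambda>u. f u * gcoeff x S + g u * gcoeff y S) U"
    by (intro holomorphic_several_add holomorphic_several_mult holomorphic_several_const assms)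
  then show "holomorphic_several (\<lambda>u. gcoeff (F u) S) U"
    by (rule holomorphic_several_cong[OF assms(1), rotated]) (simp add: assms(4) plus_grassmann.rep_eq)
qed

lemma super_holomorphic_subset: "super_holomorphic F U \<Longrightarrow> V \<subseteq> U \<Longrightarrow> super_holomorphic F V"
  unfolding super_holomorphic_def holomorphic_several_def by blast

lemma holomorphic_chart_coord: "holomorphic_several (\<lambda>z. chart_coord i z l) U"
  unfolding chart_coord_def
  by (cases "l = i") (auto intro: holomorphic_several_const holomorphic_several_component)

lemma super_holomorphic_transition:
  fixes i j :: "'n::finite option"
  defines "U \<equiv> {z :: complex ^ 'n. chart_coord i z j \<noteq> 0}"
  shows "super_holomorphic (\<lambda>z. even_tr i j z $ k) U" "super_holomorphic (\<lambda>z. odd_tr i j z $ k) U"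
proof -
  let ?v = "\<lambda>z. inverse (chart_coord i z j)" and ?y = "\<lambda>z. chart_coord i z (chart_label j k)"
  have U: "open U" by (simp add: U_def open_chart_coord_nonzero)
  have v: "holomorphic_several ?v U"
    by (rule holomorphic_several_inverse[OF holomorphic_chart_coord]) (simp add: U_def)
  note intros = v holomorphic_several_mult holomorphic_several_const holomorphic_chart_coord
  show "super_holomorphic (\<lambda>z. even_tr i j z $ k) U"
  proof (rule super_holomorphic_two_terms[OF U])
    show "holomorphic_several (\<lambda>z. ?y z * ?v z) U" "holomorphic_several (\<lambda>z. ?v z * ?v z) U"
      by (intro intros)+
    show "even_tr i j u $ k = gconst (?y u * ?v u) * 1 +
        gconst (?v u * ?v u) * (odd_coord i j * odd_coord i (chart_label j k))" if "u \<in> U" for u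
      using that by (simp add: U_def even_tr_nth glued_even_def)
  qed
  show "super_holomorphic (\<lambda>z. odd_tr i j z $ k) U"
  proof (rule super_holomorphic_two_terms[OF U v])
    show "holomorphic_several (\<lambda>z. - 1 * (?y z * (?v z * ?v z))) U"
      by (intro intros)
    show "odd_tr i j u $ k = gconst (?v u) * odd_coord i (chart_label j k) +
        gconst (- 1 * (?y u * (?v u * ?v u))) * odd_coord i j" if "u \<in> U" for u
    proof -
      have "chart_coord i u j \<noteq> 0" using that by (simp add: U_def)
      from odd_tr_nth[OF this] show ?thesis by (simp only: glued_odd_def)
    qed
  qed
qed

section \<open>The supermanifold and its Berezinian sheaf\<close>

lemma chart_coord_nonzero_overlap:
  assumes "x \<in> projective_chart_dom i \<inter> projective_chart_dom j"
  shows "chart_coord i (projective_chart i x) j \<noteq> 0"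
proof -
  obtain v where v: "x = line v" "v $ i \<noteq> 0"
    using assms by (auto simp: projective_chart_dom_def)
  then have "v \<noteq> 0" by auto
  then have "v $ j \<noteq> 0" using assms v line_in_chart_dom by auto
  then show ?thesis using v by (simp add: chart_coord_projective_chart)
qed

lemma projective_chart_change:
  assumes "x \<in> projective_chart_dom i \<inter> projective_chart_dom j"
  shows "chart_coord i (projective_chart i x) (chart_label j k) * inverse (chart_coord i (projective_chart i x) j) =
    projective_chart j x $ k"
proof -
  obtain v where v: "x = line v" "v $ i \<noteq> 0"
    using assms by (auto simp: projective_chart_dom_def)
  then have "v \<noteq> 0" by auto
  then have "v $ j \<noteq> 0" using assms v line_in_chart_dom by auto
  then show ?thesis using v
    by (simp only: chart_coord_projective_chart[OF v(2)] projective_chart_line[OF \<open>v $ j \<noteq> 0\<close>]) simp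
qed

lemma Pi_space_simps [simp]:
  "space_of (Pi_projective_space TYPE('n::finite)) = projective_topology"
  "charts (Pi_projective_space TYPE('n)) = UNIV"
  "chart_dom (Pi_projective_space TYPE('n)) = projective_chart_dom"
  "chart_map (Pi_projective_space TYPE('n)) = projective_chart"
  by (simp_all add: Pi_projective_space_def)

lemma complex_supermanifold_Pi: "complex_supermanifold (Pi_projective_space TYPE('n::finite))"
  unfolding complex_supermanifold_def Pi_space_simps
proof (intro conjI ballI allI)
  show "(\<Union>i\<in>UNIV. projective_chart_dom i) = topspace (projective_topology :: (complex ^ 'n option) set topology)"
  proof
    show "topspace projective_topology \<subseteq> (\<Union>i\<in>UNIV. projective_chart_dom (i :: 'n option))"
      unfolding topspace_projective projective_chart_dom_def by (force simp: vec_eq_iff)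
  qed (use projective_chart_dom_subset topspace_projective in blast)
next
  fix i j :: "'n option"
  have "projective_chart i ` (projective_chart_dom i \<inter> projective_chart_dom j) \<subseteq> {z. chart_coord i z j \<noteq> 0}"
    using chart_coord_nonzero_overlap by auto
  then show "super_holomorphic (\<lambda>z. even_tr i j z $ k)
        (projective_chart i ` (projective_chart_dom i \<inter> projective_chart_dom j))"
    "super_holomorphic (\<lambda>z. odd_tr i j z $ k)
        (projective_chart i ` (projective_chart_dom i \<inter> projective_chart_dom j))" for k
    by (rule super_holomorphic_subset[OF super_holomorphic_transition(1)],
      rule super_holomorphic_subset[OF super_holomorphic_transition(2)])
next
  fix i j x k assume x: "x \<in> projective_chart_dom i \<inter> projective_chart_dom (j :: 'n option)"
  note tr = even_tr_nth[OF chart_coord_nonzero_overlap[OF x]] odd_tr_nth[OF chart_coord_nonzero_overlap[OF x]]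
  show "even_element (even_tr i j (projective_chart i x) $ k)" by (simp add: tr even_glued_even)
  show "body (even_tr i j (projective_chart i x) $ k) = projective_chart j x $ k"
    by (simp add: tr body_glued_even projective_chart_change[OF x])
  show "odd_element (odd_tr i j (projective_chart i x) $ k)" by (simp add: tr odd_glued_odd)
next
  fix i :: "'n option" and z :: "(complex ^ 'n option) set" and k :: 'n
  show "even_tr i i (projective_chart i z) $ k = gconst (projective_chart i z $ k)"
    by (simp add: even_tr_nth glued_even_def)
  show "odd_tr i i (projective_chart i z) $ k = theta k"
    by (simp add: odd_tr_nth glued_odd_def)
next
  fix i j l x k
  assume x: "x \<in> projective_chart_dom i \<inter> projective_chart_dom j \<inter> projective_chart_dom (l :: 'n option)"
  have "chart_coord i (projective_chart i x) j \<noteq> 0" "chart_coord i (projective_chart i x) l \<noteq> 0"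
    using x by (auto intro!: chart_coord_nonzero_overlap)
  from pullback_transition[OF this]
  show "pullback (even_tr i j) (odd_tr i j) (\<lambda>u. even_tr j l u $ k) (projective_chart i x) =
      even_tr i l (projective_chart i x) $ k"
    "pullback (even_tr i j) (odd_tr i j) (\<lambda>u. odd_tr j l u $ k) (projective_chart i x) =
      odd_tr i l (projective_chart i x) $ k"
    by auto
qed (auto simp: Hausdorff_projective second_countable_projective openin_projective_chart_dom
    projective_chart_image projective_chart_homeomorphic[unfolded projective_chart_image, simplified])

lemma glued_sections_cong:
  assumes "\<And>i j x. i \<in> charts A \<Longrightarrow> j \<in> charts A \<Longrightarrow> x \<in> chart_dom A i \<inter> chart_dom A j \<Longrightarrow>
    c i j (chart_map A i x) = d i j (chart_map A i x)"
  shows "glued_sections A c = glued_sections A d"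
proof
  fix V
  show "glued_sections A c V = glued_sections A d V"
    unfolding glued_sections_def using assms by (intro Collect_cong conj_cong refl ball_cong) auto
qed

text \<open>
  The two sheaves are glued from the same local data by transition functions that agree on the overlaps, so
  they are equal, not merely isomorphic.
\<close>

lemma berezinian_sheaf_Pi:
  "berezinian_sheaf (Pi_projective_space TYPE('n::finite)) = structure_sheaf (Pi_projective_space TYPE('n))"
  unfolding berezinian_sheaf_def structure_sheaf_def
proof (rule glued_sections_cong)
  fix i j :: "'n option" and x
  assume "x \<in> chart_dom (Pi_projective_space TYPE('n)) i \<inter> chart_dom (Pi_projective_space TYPE('n)) j"
  then have "chart_coord i (projective_chart i x) j \<noteq> 0"
    unfolding Pi_space_simps by (rule chart_coord_nonzero_overlap)
  from Ber_transition[OF this]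
  show "Ber (transition_jacobian i j (chart_map (Pi_projective_space TYPE('n)) i x)) = 1"
    unfolding Pi_space_simps .
qed

lemma module_sheaf_iso_refl: "module_sheaf_iso A \<F> \<F>"
  unfolding module_sheaf_iso_def by (intro exI[of _ "\<lambda>V s. s"]) (auto simp: bij_betw_def)

theorem theorem4p4:
  fixes n :: nat
  assumes "n \<ge> 1" and "CARD('n::finite) = n"
  shows "module_sheaf_iso (Pi_projective_space TYPE('n))
           (berezinian_sheaf (Pi_projective_space TYPE('n)))
           (structure_sheaf (Pi_projective_space TYPE('n))) \<and>
         calabi_yau (Pi_projective_space TYPE('n))"
  by (simp add: calabi_yau_def berezinian_sheaf_Pi module_sheaf_iso_refl complex_supermanifold_Pi)

end
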